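(* Let ${\rm L}$ be a language of one of the two types described in the context. The universal theory of any axiomatizable hereditary class $K$ of ${\rm L}$-structures with a recursive set of minimal forbidden substructures is decidable.
   Context: Languages and structures. The language ${\rm L}$ is first-order with equality, has only predicate symbols (no function or constant symbols), and is of one of two types: (i) the finite language ${\rm L} = {\rm L_{fin}} = \langle R_1,\ldots,R_m,=\rangle$; or (ii) the infinite language ${\rm L} = {\rm L_{fin}} \cup {\rm L_\infty}$, where ${\rm L_{fin}} = \langle R_1,\ldots,R_m,=\rangle$ and ${\rm L_\infty} = \langle R_{m+1},R_{m+2},\ldots\rangle$, the number of predicates of each arity in ${\rm L_\infty}$ is finite, and the predicates of ${\rm L_\infty}$ are ordered in ascending order of their arities. Write $n_k$ for the arity of $R_k$. An ${\rm L}$-structure is a nonempty set $A$ with an interpretation of each $R_k$ as an $n_k$-ary relation on $A$ (and $=$ as equality), such that every $R_k \in {\rm L_\infty}$ satisfies the property of non-repetition of elements: $\forall x_1\ldots\forall x_l\,[R_k(x_1,\ldots,x_l)\rightarrow\bigwedge_{i\neq j} (x_i\neq x_j)]$, where $l=n_k$. A substructure of an ${\rm L}$-structure is a nonempty subset of it with the restrictions of all predicates. All classes of ${\rm L}$-structures considered are abstract, i.e. closed under isomorphism. A class is hereditary if it is closed under substructures. A class is axiomatizable if there is a set $Z$ of first-order ${\rm L}$-sentences such that the class consists of all ${\rm L}$-structures that satisfy $Z$. For a set $H$ of ${\rm L}$-structures, $Forb(H)$ is the class of all ${\rm L}$-structures that do not contain substructures from $H$, where being from $H$ is understood up to isomorphism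 (a structure counts as a substructure of itself). A set $H$ of ${\rm L}$-structures is a set of minimal forbidden substructures for a class $K$ if $K=Forb(H)$ and, for every ${\rm L}$-structure in $H$, none of its proper substructures belongs to $H$ (again up to isomorphism). A set of forbidden substructures of the language ${\rm L}$ is called recursive if there exists a Gödel numbering $g$ of these substructures such that the set of their numbers is recursive, i.e. there is an algorithm that for any natural number outputs "YES" if it belongs to the set of these numbers and "NO" otherwise. A universal sentence is a sentence $\forall x_1\ldots\forall x_n\,\psi$ with $\psi$ a quantifier-free formula containing no variables except $x_1,\ldots,x_n$. The universal theory of $K$ is the set of all universal ${\rm L}$-sentences true in all structures from $K$. It is decidable if there is an algorithm that, for any universal ${\rm L}$-sentence, determines whether or not this sentence belongs to it.
   Formalization: For the infinite language, the map from k to the arity n_k is additionally assumed to be recursive (false otherwise for suitable non-recursive arities); Gödel numberings are taken to be effective in both directions. *)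

theory Defs
  imports Main "HOL-Library.Nat_Bijection"
begin

section \<open>Recursive functions and sets\<close>

text \<open>
  Kleene's total recursive functions: \<open>recfn n f\<close> says that \<open>f\<close>, regarded as a function of argument
  lists of length \<open>n\<close>, is recursive (its values on lists of any other length are irrelevant).
  Minimization is only applied to regular functions, which by Kleene's normal form theorem
  yields exactly the total computable functions.
\<close>

inductive recfn :: "nat \<Rightarrow> (nat list \<Rightarrow> nat) \<Rightarrow> bool" where
  zero: "recfn n (\<lambda>_. 0)"
| succ: "recfn 1 (\<lambda>xs. Suc (xs ! 0))"
| proj: "i < n \<Longrightarrow> recfn n (\<lambda>xs. xs ! i)"
| comp: "recfn (length gs) f \<Longrightarrow> (\<And>g. g \<in> set gs \<Longrightarrow> recfn n g) \<Longrightarrow>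
    recfn n (\<lambda>xs. f (map (\<lambda>g. g xs) gs))"
| prec: "recfn n f \<Longrightarrow> recfn (Suc (Suc n)) g \<Longrightarrow>
    recfn (Suc n) (\<lambda>xs. rec_nat (f (tl xs)) (\<lambda>k r. g (k # r # tl xs)) (hd xs))"
| mu: "recfn (Suc n) f \<Longrightarrow> (\<And>xs. length xs = n \<Longrightarrow> \<exists>y. f (y # xs) = 0) \<Longrightarrow>
    recfn n (\<lambda>xs. LEAST y. f (y # xs) = 0)"

definition recursive_fun :: "(nat \<Rightarrow> nat) \<Rightarrow> bool" where
  "recursive_fun f \<longleftrightarrow> (\<exists>F. recfn 1 F \<and> (\<forall>x. F [x] = f x))"

definition recursive_set :: "nat set \<Rightarrow> bool" where
  "recursive_set S \<longleftrightarrow> recursive_fun (\<lambda>x. if x \<in> S then 1 else 0)"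


section \<open>Relational languages\<close>

text \<open>
  The predicate symbol \<open>R\<^sub>k\<close> is represented by its index \<open>k \<ge> 1\<close>; the symbols
  of the finite part have the indices \<open>1, \<dots>, nfin L\<close>, those of the infinite part the larger ones.
  Values of \<open>arity L\<close> outside \<open>preds L\<close> carry no information.
\<close>

record lang =
  nfin :: nat
  preds :: "nat set"
  arity :: "nat \<Rightarrow> nat"

definition finite_type :: "lang \<Rightarrow> bool" where
  "finite_type L \<longleftrightarrow> preds L = {1..nfin L}"

definition infinite_type :: "lang \<Rightarrow> bool" where
  "infinite_type L \<longleftrightarrow> preds L = {1..} \<and>
     (\<forall>l. finite {k. nfin L < k \<and> arity L k = l}) \<and>
     mono_on {nfin L<..} (arity L)"

text \<open>
  Algorithms working on sentences and on finite structures of an infinite language presuppose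
  that the language itself is given effectively.  For finite languages this always holds.
\<close>

definition effective_arities :: "lang \<Rightarrow> bool" where
  "effective_arities L \<longleftrightarrow> (\<exists>f. recursive_fun f \<and> (\<forall>k\<in>preds L. f k = arity L k))"


section \<open>Structures\<close>

record 'a fo_struct =
  carrier :: "'a set"
  rel :: "nat \<Rightarrow> 'a list set"

text \<open>
  Relations at indices that are not symbols of \<open>L\<close> are fixed to be empty, so that equality of
  records is equality of \<open>L\<close>-structures.
\<close>

definition is_struct :: "lang \<Rightarrow> 'a fo_struct \<Rightarrow> bool" where
  "is_struct L A \<longleftrightarrow> carrier A \<noteq> {} \<and>
     (\<forall>k\<in>preds L. \<forall>xs\<in>rel A k. length xs = arity L k \<and> set xs \<subseteq> carrier A) \<and>
     (\<forall>k\<in>preds L. nfin L < k \<longrightarrow> (\<forall>xs\<in>rel A k. distinct xs)) \<and>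
     (\<forall>k. k \<notin> preds L \<longrightarrow> rel A k = {})"

definition substructure :: "'a fo_struct \<Rightarrow> 'a fo_struct \<Rightarrow> bool" where
  "substructure B A \<longleftrightarrow> carrier B \<noteq> {} \<and> carrier B \<subseteq> carrier A \<and>
     (\<forall>k. rel B k = {xs \<in> rel A k. set xs \<subseteq> carrier B})"

definition proper_substructure :: "'a fo_struct \<Rightarrow> 'a fo_struct \<Rightarrow> bool" where
  "proper_substructure B A \<longleftrightarrow> substructure B A \<and> carrier B \<noteq> carrier A"

definition isomorphic :: "lang \<Rightarrow> 'a fo_struct \<Rightarrow> 'b fo_struct \<Rightarrow> bool" where
  "isomorphic L A B \<longleftrightarrow> (\<exists>f. bij_betw f (carrier A) (carrier B) \<and>
     (\<forall>k\<in>preds L. \<forall>xs. length xs = arity L k \<longrightarrow> set xs \<subseteq> carrier A \<longrightarrow>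
        (xs \<in> rel A k \<longleftrightarrow> map f xs \<in> rel B k)))"


section \<open>First-order formulas\<close>

datatype fm =
    Equal nat nat
  | Atom nat "nat list"
  | Neg fm
  | Conj fm fm
  | Forall nat fm

primrec wf_fm :: "lang \<Rightarrow> fm \<Rightarrow> bool" where
  "wf_fm L (Equal i j) \<longleftrightarrow> True"
| "wf_fm L (Atom k vs) \<longleftrightarrow> k \<in> preds L \<and> length vs = arity L k"
| "wf_fm L (Neg \<phi>) \<longleftrightarrow> wf_fm L \<phi>"
| "wf_fm L (Conj \<phi> \<psi>) \<longleftrightarrow> wf_fm L \<phi> \<and> wf_fm L \<psi>"
| "wf_fm L (Forall i \<phi>) \<longleftrightarrow> wf_fm L \<phi>"

primrec fv :: "fm \<Rightarrow> nat set" where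
  "fv (Equal i j) = {i, j}"
| "fv (Atom k vs) = set vs"
| "fv (Neg \<phi>) = fv \<phi>"
| "fv (Conj \<phi> \<psi>) = fv \<phi> \<union> fv \<psi>"
| "fv (Forall i \<phi>) = fv \<phi> - {i}"

primrec quantifier_free :: "fm \<Rightarrow> bool" where
  "quantifier_free (Equal i j) \<longleftrightarrow> True"
| "quantifier_free (Atom k vs) \<longleftrightarrow> True"
| "quantifier_free (Neg \<phi>) \<longleftrightarrow> quantifier_free \<phi>"
| "quantifier_free (Conj \<phi> \<psi>) \<longleftrightarrow> quantifier_free \<phi> \<and> quantifier_free \<psi>"
| "quantifier_free (Forall i \<phi>) \<longleftrightarrow> False"

definition sentence :: "lang \<Rightarrow> fm \<Rightarrow> bool" where
  "sentence L \<phi> \<longleftrightarrow> wf_fm L \<phi> \<and> fv \<phi> = {}"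

definition universal_sentence :: "lang \<Rightarrow> fm \<Rightarrow> bool" where
  "universal_sentence L \<phi> \<longleftrightarrow> (\<exists>vs \<psi>. \<phi> = foldr Forall vs \<psi> \<and> wf_fm L \<psi> \<and>
     quantifier_free \<psi> \<and> fv \<psi> \<subseteq> set vs)"

primrec sat :: "'a fo_struct \<Rightarrow> (nat \<Rightarrow> 'a) \<Rightarrow> fm \<Rightarrow> bool" where
  "sat A e (Equal i j) \<longleftrightarrow> e i = e j"
| "sat A e (Atom k vs) \<longleftrightarrow> map e vs \<in> rel A k"
| "sat A e (Neg \<phi>) \<longleftrightarrow> \<not> sat A e \<phi>"
| "sat A e (Conj \<phi> \<psi>) \<longleftrightarrow> sat A e \<phi> \<and> sat A e \<psi>"
| "sat A e (Forall i \<phi>) \<longleftrightarrow> (\<forall>a\<in>carrier A. sat A (e(i := a)) \<phi>)"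

definition models :: "'a fo_struct \<Rightarrow> fm \<Rightarrow> bool" where
  "models A \<phi> \<longleftrightarrow> (\<forall>e. range e \<subseteq> carrier A \<longrightarrow> sat A e \<phi>)"


section \<open>Classes of structures\<close>

text \<open>
  A class of \<open>L\<close>-structures is represented by its members with carrier contained in a type \<open>'a\<close>.
  As there are only countably many symbols, by the downward Loewenheim-Skolem theorem an
  infinite \<open>'a\<close> suffices to represent axiomatizable classes faithfully.
\<close>

definition abstract_class :: "lang \<Rightarrow> 'a fo_struct set \<Rightarrow> bool" where
  "abstract_class L K \<longleftrightarrow> (\<forall>A\<in>K. is_struct L A) \<and>
     (\<forall>A\<in>K. \<forall>B. is_struct L B \<and> isomorphic L A B \<longrightarrow> B \<in> K)"

definition hereditary :: "'a fo_struct set \<Rightarrow> bool" where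
  "hereditary K \<longleftrightarrow> (\<forall>A\<in>K. \<forall>B. substructure B A \<longrightarrow> B \<in> K)"

definition axiomatizable :: "lang \<Rightarrow> 'a fo_struct set \<Rightarrow> bool" where
  "axiomatizable L K \<longleftrightarrow> (\<exists>Z. (\<forall>\<phi>\<in>Z. sentence L \<phi>) \<and>
     K = {A. is_struct L A \<and> (\<forall>\<phi>\<in>Z. models A \<phi>)})"

definition Forb :: "lang \<Rightarrow> 'a fo_struct set \<Rightarrow> 'a fo_struct set" where
  "Forb L H = {A. is_struct L A \<and>
     \<not> (\<exists>B. substructure B A \<and> (\<exists>C\<in>H. isomorphic L B C))}"

definition minimal_forbidden :: "lang \<Rightarrow> 'a fo_struct set \<Rightarrow> 'a fo_struct set \<Rightarrow> bool" where
  "minimal_forbidden L K H \<longleftrightarrow> (\<forall>A\<in>H. is_struct L A) \<and> K = Forb L H \<and>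
     (\<forall>A\<in>H. \<not> (\<exists>B. proper_substructure B A \<and> (\<exists>C\<in>H. isomorphic L B C)))"

definition universal_theory :: "lang \<Rightarrow> 'a fo_struct set \<Rightarrow> fm set" where
  "universal_theory L K = {\<phi>. universal_sentence L \<phi> \<and> (\<forall>A\<in>K. models A \<phi>)}"


section \<open>Goedel numberings of finite structures\<close>

definition finite_presentations :: "lang \<Rightarrow> nat fo_struct set" where
  "finite_presentations L = {A. is_struct L A \<and> (\<exists>n. carrier A = {..<n})}"

text \<open>
  The standard number of a finite structure on \<open>{..<n}\<close> codes \<open>n\<close> and the set of all facts
  \<open>R\<^sub>k(xs)\<close> that hold in it.  There are only finitely many such facts, since by
  non-repetition a symbol of the infinite part whose arity exceeds \<open>n\<close> has an empty relation.
\<close>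

definition diagram :: "'a fo_struct \<Rightarrow> (nat \<times> 'a list) set" where
  "diagram A = {(k, xs). xs \<in> rel A k}"

definition struct_code :: "nat fo_struct \<Rightarrow> nat" where
  "struct_code A = prod_encode (card (carrier A),
     set_encode ((\<lambda>(k, xs). prod_encode (k, list_encode xs)) ` diagram A))"

text \<open>
  A Goedel numbering has to be effective in both directions: the number can be computed from a
  presentation of the structure, and a presentation of an isomorphic copy from the number.
  Both numberings of presentations and numberings of isomorphism types are covered.
  (For a merely injective assignment of numbers, every countable set of structures would have a
  recursive set of numbers.)
\<close>

definition goedel_numbering :: "lang \<Rightarrow> (nat fo_struct \<Rightarrow> nat) \<Rightarrow> bool" where
  "goedel_numbering L g \<longleftrightarrow>
     (\<exists>c. recursive_fun c \<and> (\<forall>A\<in>finite_presentations L. g A = c (struct_code A))) \<and>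
     (\<exists>d. recursive_fun d \<and> (\<forall>A\<in>finite_presentations L. \<exists>B\<in>finite_presentations L.
        isomorphic L A B \<and> d (g A) = struct_code B))"

text \<open>
  Only finite structures have numbers.  Finiteness of the members of \<open>H\<close> is not demanded; it is
  automatic, by compactness, for minimal forbidden substructures of an axiomatizable class.
\<close>

definition recursive_structs :: "lang \<Rightarrow> 'a fo_struct set \<Rightarrow> bool" where
  "recursive_structs L H \<longleftrightarrow> (\<exists>g. goedel_numbering L g \<and>
     recursive_set (g ` {B \<in> finite_presentations L. \<exists>A\<in>H. isomorphic L A B}))"


section \<open>Decidability of the universal theory\<close>

primrec fm_code :: "fm \<Rightarrow> nat" where
  "fm_code (Equal i j) = prod_encode (0, prod_encode (i, j))"
| "fm_code (Atom k vs) = prod_encode (1, prod_encode (k, list_encode vs))"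
| "fm_code (Neg \<phi>) = prod_encode (2, fm_code \<phi>)"
| "fm_code (Conj \<phi> \<psi>) = prod_encode (3, prod_encode (fm_code \<phi>, fm_code \<psi>))"
| "fm_code (Forall i \<phi>) = prod_encode (4, prod_encode (i, fm_code \<phi>))"

definition decidable_universal_theory :: "lang \<Rightarrow> 'a fo_struct set \<Rightarrow> bool" where
  "decidable_universal_theory L K \<longleftrightarrow> (\<exists>d. recursive_fun d \<and>
     (\<forall>\<phi>. universal_sentence L \<phi> \<longrightarrow>
        d (fm_code \<phi>) = (if \<phi> \<in> universal_theory L K then 1 else 0)))"


section \<open>Well-definedness of the codings\<close>

lemma fm_code_inject: "fm_code \<phi> = fm_code \<psi> \<Longrightarrow> \<phi> = \<psi>"
proof (induction \<phi> arbitrary: \<psi>)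
  case (Equal i j) then show ?case by (cases \<psi>) auto
next
  case (Atom k vs) then show ?case by (cases \<psi>) (auto simp: list_encode_eq)
next
  case (Neg \<phi>) then show ?case by (cases \<psi>) auto
next
  case (Conj \<phi>1 \<phi>2) then show ?case by (cases \<psi>) auto
next
  case (Forall i \<phi>) then show ?case by (cases \<psi>) auto
qed

lemma finite_diagram:
  assumes L: "finite_type L \<or> infinite_type L" and A: "is_struct L A" and fin: "finite (carrier A)"
  shows "finite (diagram A)"
proof -
  define P where "P = {k \<in> preds L. k \<le> nfin L \<or> arity L k \<le> card (carrier A)}"
  have "finite P"
    using L
  proof
    assume "finite_type L"
    then show ?thesis by (simp add: P_def finite_type_def)
  next
    assume "infinite_type L"
    then have "finite (\<Union>l\<le>card (carrier A). {k. nfin L < k \<and> arity L k = l})"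
      by (auto simp: infinite_type_def)
    then show ?thesis
      by (rule finite_subset[rotated, OF finite_UnI[OF finite_atMost[of "nfin L"]]])
        (auto simp: P_def)
  qed
  moreover have "diagram A \<subseteq> (SIGMA k:P. {xs. set xs \<subseteq> carrier A \<and> length xs = arity L k})"
  proof clarify
    fix k xs assume "(k, xs) \<in> diagram A"
    then have xs: "xs \<in> rel A k" by (simp add: diagram_def)
    with A have k: "k \<in> preds L" by (auto simp: is_struct_def)
    with A xs have *: "length xs = arity L k" "set xs \<subseteq> carrier A"
      by (auto simp: is_struct_def)
    have "arity L k \<le> card (carrier A)" if "nfin L < k"
    proof -
      have "distinct xs" using A k xs that by (simp add: is_struct_def)
      then have "length xs = card (set xs)" by (simp add: distinct_card)
      then show ?thesis using * card_mono[OF fin *(2)] by simp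
    qed
    then have "k \<in> P" using k by (cases "nfin L < k") (auto simp: P_def)
    with * show "k \<in> P \<and> xs \<in> {xs. set xs \<subseteq> carrier A \<and> length xs = arity L k}"
      by simp
  qed
  ultimately show ?thesis
    using finite_lists_length_eq[OF fin] by (meson finite_SigmaI finite_subset)
qed

lemma struct_code_inject:
  assumes L: "finite_type L \<or> infinite_type L"
    and A: "A \<in> finite_presentations L" and B: "B \<in> finite_presentations L"
    and eq: "struct_code A = struct_code B"
  shows "A = B"
proof -
  let ?h = "\<lambda>(k, xs). prod_encode (k, list_encode xs)"
  obtain a b where ab: "carrier A = {..<a}" "carrier B = {..<b}"
    using A B by (auto simp: finite_presentations_def)
  then have "finite (diagram A)" "finite (diagram B)"
    using A B finite_diagram[OF L, of A] finite_diagram[OF L, of B]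
    by (auto simp: finite_presentations_def)
  then have "?h ` diagram A = ?h ` diagram B"
    using eq by (simp add: struct_code_def set_encode_eq)
  moreover have "inj ?h" by (auto simp: inj_def list_encode_eq)
  ultimately have "diagram A = diagram B" by (simp add: inj_image_eq_iff)
  then have "rel A = rel B" by (auto simp: diagram_def fun_eq_iff set_eq_iff)
  moreover have "carrier A = carrier B" using eq ab by (simp add: struct_code_def)
  ultimately show ?thesis by simp
qed

lemma goedel_numbering_struct_code: "goedel_numbering L struct_code"
proof -
  have "recursive_fun (\<lambda>x. x)"
    unfolding recursive_fun_def by (rule exI[of _ "\<lambda>xs. xs ! 0"]) (auto intro: recfn.proj)
  moreover have "isomorphic L A A" for A :: "nat fo_struct"
    unfolding isomorphic_def by (rule exI[of _ "\<lambda>x. x"]) (simp add: bij_betw_def)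
  ultimately show ?thesis unfolding goedel_numbering_def by blast
qed

lemma const_recfn: "recfn n (\<lambda>_. c)"
proof (induction c)
  case 0 show ?case by (rule recfn.zero)
next
  case (Suc c)
  show ?case using recfn.comp[of "[\<lambda>_. c]" "\<lambda>xs. Suc (xs ! 0)" n] Suc recfn.succ by simp
qed

lemma finite_type_effective_arities:
  assumes "finite_type L"
  shows "effective_arities L"
proof -
  have "\<exists>F. recfn 1 F \<and> (\<forall>k\<le>m. F [k] = a k)" for m and a :: "nat \<Rightarrow> nat"
  proof (induction m arbitrary: a)
    case 0
    then show ?case by (rule exI[of _ "\<lambda>_. a 0"]) (simp add: const_recfn)
  next
    case (Suc m)
    from Suc[of "\<lambda>k. a (Suc k)"] obtain F
      where F: "recfn 1 F" "\<forall>k\<le>m. F [k] = a (Suc k)" by blast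
    have "recfn (Suc (Suc 0)) (\<lambda>xs. F [xs ! 0])"
      using recfn.comp[of "[\<lambda>xs. xs ! 0]" F "Suc (Suc 0)"] F(1) by (simp add: recfn.proj)
    from recfn.prec[OF const_recfn[of 0 "a 0"] this]
    have "recfn 1 (\<lambda>xs. rec_nat (a 0) (\<lambda>k r. F [k]) (hd xs))" by simp
    moreover have "rec_nat (a 0) (\<lambda>k r. F [k]) k = a k" if "k \<le> Suc m" for k
      using that F(2) by (cases k) auto
    ultimately show ?case by (intro exI conjI) auto
  qed
  then obtain F where "recfn 1 F" "\<forall>k\<le>nfin L. F [k] = arity L k" by blast
  then show ?thesis
    using assms unfolding effective_arities_def recursive_fun_def finite_type_def
    by (intro exI[of _ "\<lambda>k. F [k]"]) auto
qed

end

theory Submission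
  imports Defs
begin

text \<open>
  A universal sentence that fails in some structure of \<open>K\<close> fails already in a finite substructure, namely
  on the values of its variables under a failing assignment. Since \<open>K = Forb L H\<close> is determined by the
  omission of substructures, this finite substructure is again, up to isomorphism, in \<open>K\<close>. Hence a universal sentence
  with code \<open>x\<close> belongs to the universal theory of \<open>K\<close> iff it holds in all structures on \<open>{..<m}\<close> with
  \<open>m \<le> x + 1\<close> that omit \<open>H\<close> (\<open>universal_theory_Forb_iff\<close>; variables are bounded by the code of the
  sentence).

  This is a finite check. On \<open>m\<close> elements only finitely many symbols can have nonempty relations, because of
  non-repetition, and a bound on the codes of the possible structures is recursive in \<open>m\<close>
  (\<open>structure_code_bound\<close>). A structure omits \<open>H\<close> iff no member of \<open>H\<close> embeds into it; such a member
  would be finite and no larger than the structure, so that only finitely many presentations and embeddings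
  have to be examined (\<open>not_omits_structure_of_iff\<close>), and whether a presentation is a copy of a member of
  \<open>H\<close> is decided by the recursive set of Goedel numbers (\<open>recursive_structs_membership\<close>). Finally, truth of
  a formula in a coded finite structure under a coded assignment is computed by course-of-values recursion on
  the code of the formula (\<open>fm_code_mem_truth_set\<close>).

  That all this is recursive in Kleene's sense is shown by writing each notion as an arithmetical formula with
  bounded quantifiers, for which the closure properties of recursive functions suffice.
\<close>

section \<open>Closure properties of recursive functions\<close>

text \<open>
  The predicate \<open>recfn n\<close> is sensitive to the values of a function on lists of length other than \<open>n\<close>.
  Identifying functions that agree on lists of length \<open>n\<close> makes it closed under rewriting.
\<close>

definition computable :: "nat \<Rightarrow> (nat list \<Rightarrow> nat) \<Rightarrow> bool" where
  "computable n f \<longleftrightarrow> (\<exists>F. recfn n F \<and> (\<forall>xs. length xs = n \<longrightarrow> F xs = f xs))"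

text \<open>
  In \<open>decidable n (\<lambda>xs. P xs)\<close> and \<open>computable n (\<lambda>xs. f xs)\<close> the list \<open>xs\<close> holds the values of the
  free variables. Binding a further variable, by a bounded quantifier, by minimization or by primitive
  recursion, puts its value in front, so that outer variables appear as \<open>tl xs ! i\<close>,
  \<open>tl (tl xs) ! i\<close> and so on. The rules collected below decompose the defining term of a function or
  predicate along its syntax.
\<close>

definition decidable :: "nat \<Rightarrow> (nat list \<Rightarrow> bool) \<Rightarrow> bool" where
  "decidable n P \<longleftrightarrow> computable n (\<lambda>xs. if P xs then 1 else 0)"

named_theorems recursive_intros

lemma computable_cong:
  assumes "computable n f" and "\<And>xs. length xs = n \<Longrightarrow> f xs = g xs"
  shows "computable n g"
  using assms unfolding computable_def by force

lemma decidable_cong: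
  assumes "decidable n P" and "\<And>xs. length xs = n \<Longrightarrow> P xs = Q xs"
  shows "decidable n Q"
  using assms(1) unfolding decidable_def by (rule computable_cong) (simp add: assms(2))

lemma recursive_fun_iff_computable: "recursive_fun f \<longleftrightarrow> computable 1 (\<lambda>xs. f (xs ! 0))"
proof
  assume "recursive_fun f"
  then obtain F where "recfn 1 F" "\<forall>x. F [x] = f x" unfolding recursive_fun_def by blast
  then show "computable 1 (\<lambda>xs. f (xs ! 0))"
    unfolding computable_def by (intro exI[of _ F]) (auto simp: length_Suc_conv)
next
  assume "computable 1 (\<lambda>xs. f (xs ! 0))"
  then obtain F where "recfn 1 F" "\<forall>xs. length xs = 1 \<longrightarrow> F xs = f (xs ! 0)"
    unfolding computable_def by blast
  then show "recursive_fun f"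
    unfolding recursive_fun_def by (intro exI[of _ F]) auto
qed

lemma computable_comp:
  assumes f: "computable (length gs) f" and gs: "\<And>g. g \<in> set gs \<Longrightarrow> computable n g"
  shows "computable n (\<lambda>xs. f (map (\<lambda>g. g xs) gs))"
proof -
  obtain F where F: "recfn (length gs) F" "\<And>xs. length xs = length gs \<Longrightarrow> F xs = f xs"
    using f unfolding computable_def by blast
  have "\<forall>g\<in>set gs. \<exists>G. recfn n G \<and> (\<forall>xs. length xs = n \<longrightarrow> G xs = g xs)"
    using gs unfolding computable_def by blast
  then obtain G where G: "\<And>g. g \<in> set gs \<Longrightarrow> recfn n (G g)"
    "\<And>g xs. g \<in> set gs \<Longrightarrow> length xs = n \<Longrightarrow> G g xs = g xs"
    by metis
  have "recfn n (\<lambda>xs. F (map (\<lambda>g. g xs) (map G gs)))"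
    using F(1) G(1) by (intro recfn.comp) auto
  moreover have "F (map (\<lambda>g. g xs) (map G gs)) = f (map (\<lambda>g. g xs) gs)" if "length xs = n" for xs
  proof -
    have "map (\<lambda>g. g xs) (map G gs) = map (\<lambda>g. g xs) gs"
      using G(2) that by simp
    then show ?thesis using F(2)[of "map (\<lambda>g. g xs) gs"] by (simp only: length_map)
  qed
  ultimately show ?thesis unfolding computable_def by blast
qed

text \<open>
  Once a function of \<open>k\<close> arguments is known to be recursive in the variables \<open>xs ! 0, \<dots>\<close>, the following
  instances of composition allow arbitrary recursive terms as its arguments.
\<close>

lemma computable_comp1:
  assumes "computable 1 (\<lambda>xs. f (xs ! 0))" and "computable n a"
  shows "computable n (\<lambda>xs. f (a xs))"
  using computable_comp[of "[a]" "\<lambda>xs. f (xs ! 0)" n] assms by auto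

lemma computable_comp2:
  assumes "computable 2 (\<lambda>xs. f (xs ! 0) (xs ! 1))" and "computable n a" and "computable n b"
  shows "computable n (\<lambda>xs. f (a xs) (b xs))"
  using computable_comp[of "[a, b]" "\<lambda>xs. f (xs ! 0) (xs ! 1)" n] assms
  by (auto simp: numeral_2_eq_2)

lemma computable_comp3:
  assumes "computable 3 (\<lambda>xs. f (xs ! 0) (xs ! 1) (xs ! 2))"
    and "computable n a" and "computable n b" and "computable n c"
  shows "computable n (\<lambda>xs. f (a xs) (b xs) (c xs))"
  using computable_comp[of "[a, b, c]" "\<lambda>xs. f (xs ! 0) (xs ! 1) (xs ! 2)" n] assms
  by (auto simp: eval_nat_numeral)

lemma computable_comp4:
  assumes "computable 4 (\<lambda>xs. f (xs ! 0) (xs ! 1) (xs ! 2) (xs ! 3))"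
    and "computable n a" and "computable n b" and "computable n c" and "computable n d"
  shows "computable n (\<lambda>xs. f (a xs) (b xs) (c xs) (d xs))"
  using computable_comp[of "[a, b, c, d]" "\<lambda>xs. f (xs ! 0) (xs ! 1) (xs ! 2) (xs ! 3)" n] assms
  by (auto simp: eval_nat_numeral)

lemma computable_comp5:
  assumes "computable 5 (\<lambda>xs. f (xs ! 0) (xs ! 1) (xs ! 2) (xs ! 3) (xs ! 4))"
    and "computable n a" and "computable n b" and "computable n c" and "computable n d"
    and "computable n e"
  shows "computable n (\<lambda>xs. f (a xs) (b xs) (c xs) (d xs) (e xs))"
  using computable_comp[of "[a, b, c, d, e]" "\<lambda>xs. f (xs ! 0) (xs ! 1) (xs ! 2) (xs ! 3) (xs ! 4)" n]
    assms
  by (auto simp: eval_nat_numeral)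

lemmas decidable_comp1 =
  computable_comp1[where f = "\<lambda>x. if P x then 1 else 0" for P,
    folded decidable_def]
lemmas decidable_comp2 =
  computable_comp2[where f = "\<lambda>x y. if P x y then 1 else 0" for P,
    folded decidable_def]
lemmas decidable_comp3 =
  computable_comp3[where f = "\<lambda>x y z. if P x y z then 1 else 0" for P,
    folded decidable_def]
lemmas decidable_comp4 =
  computable_comp4[where f = "\<lambda>x y z u. if P x y z u then 1 else 0" for P,
    folded decidable_def]
lemmas decidable_comp5 =
  computable_comp5[where f = "\<lambda>x y z u v. if P x y z u v then 1 else 0" for P,
    folded decidable_def]

lemma computable_const [recursive_intros]: "computable n (\<lambda>_. c)"
  unfolding computable_def using const_recfn by blast

lemma computable_nth [recursive_intros]:
  "i < n \<Longrightarrow> computable n (\<lambda>xs. xs ! i)"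
  unfolding computable_def using recfn.proj by blast

lemma computable_nth_tl [recursive_intros]:
  "Suc i < n \<Longrightarrow> computable n (\<lambda>xs. tl xs ! i)"
  by (rule computable_cong[OF computable_nth[of "Suc i"]]) (auto simp: nth_tl)

lemma computable_nth_tl2 [recursive_intros]:
  "Suc (Suc i) < n \<Longrightarrow> computable n (\<lambda>xs. tl (tl xs) ! i)"
  by (rule computable_cong[OF computable_nth[of "Suc (Suc i)"]]) (auto simp: nth_tl)

lemma computable_nth_tl3 [recursive_intros]:
  "Suc (Suc (Suc i)) < n \<Longrightarrow> computable n (\<lambda>xs. tl (tl (tl xs)) ! i)"
  by (rule computable_cong[OF computable_nth[of "Suc (Suc (Suc i))"]]) (auto simp: nth_tl)

lemma computable_Suc [recursive_intros]:
  assumes "computable n f"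
  shows "computable n (\<lambda>xs. Suc (f xs))"
proof (rule computable_comp1[OF _ assms])
  show "computable 1 (\<lambda>xs. Suc (xs ! 0))"
    unfolding computable_def using recfn.succ by blast
qed

text \<open>
  The parameters of the recursion are all the variables \<open>xs\<close>; composing with the bound \<open>b\<close> and with all
  projections brings Kleene's scheme, which recurses on the head of the list, into this form.
\<close>

lemma computable_rec_nat [recursive_intros]:
  assumes f: "computable n f" and g: "computable (Suc (Suc n)) (\<lambda>zs. g (zs ! 0) (zs ! 1) (tl (tl zs)))"
    and b: "computable n b"
  shows "computable n (\<lambda>xs. rec_nat (f xs) (\<lambda>k r. g k r xs) (b xs))"
proof -
  let ?h = "\<lambda>xs. rec_nat (f (tl xs)) (\<lambda>k r. g k r (tl xs)) (hd xs)"
  obtain F where F: "recfn n F" "\<And>xs. length xs = n \<Longrightarrow> F xs = f xs"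
    using f unfolding computable_def by blast
  obtain G where G: "recfn (Suc (Suc n)) G"
    "\<And>zs. length zs = Suc (Suc n) \<Longrightarrow> G zs = g (zs ! 0) (zs ! 1) (tl (tl zs))"
    using g unfolding computable_def by blast
  have "computable (Suc n) ?h"
    unfolding computable_def
  proof (intro exI conjI allI impI)
    show "recfn (Suc n) (\<lambda>xs. rec_nat (F (tl xs)) (\<lambda>k r. G (k # r # tl xs)) (hd xs))"
      by (rule recfn.prec[OF F(1) G(1)])
  next
    fix xs :: "nat list" assume "length xs = Suc n"
    then have "F (tl xs) = f (tl xs)" "\<And>k r. G (k # r # tl xs) = g k r (tl xs)"
      using F(2) G(2) by auto
    then show "rec_nat (F (tl xs)) (\<lambda>k r. G (k # r # tl xs)) (hd xs) = ?h xs" by simp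
  qed
  then have "computable n (\<lambda>xs. ?h (map (\<lambda>g. g xs) (b # map (\<lambda>i xs. xs ! i) [0..<n])))"
    using b by (intro computable_comp) (auto intro: computable_nth)
  then show ?thesis
  proof (rule computable_cong)
    fix xs :: "nat list" assume "length xs = n"
    then have "map (\<lambda>i. xs ! i) [0..<n] = xs" using map_nth by blast
    then show "?h (map (\<lambda>g. g xs) (b # map (\<lambda>i xs. xs ! i) [0..<n])) =
      rec_nat (f xs) (\<lambda>k r. g k r xs) (b xs)"
      by (simp add: comp_def)
  qed
qed

text \<open>
  Definition by cases is a recursion of length 0 or 1 along the characteristic function.
\<close>

lemma computable_if [recursive_intros]:
  assumes "decidable n P" and "computable n f" and "computable n g"
  shows "computable n (\<lambda>xs. if P xs then f xs else g xs)"
proof -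
  have "computable 3 (\<lambda>xs. rec_nat (xs ! 2) (\<lambda>k r. xs ! 1) (xs ! 0))"
    by (intro recursive_intros) auto
  from computable_comp3[OF this assms(1)[unfolded decidable_def] assms(2,3)]
  show ?thesis by (rule computable_cong) simp
qed

lemma decidable_not [recursive_intros]:
  assumes "decidable n P"
  shows "decidable n (\<lambda>xs. \<not> P xs)"
  using computable_if[OF assms computable_const[of n 0] computable_const[of n 1]]
  unfolding decidable_def by (rule computable_cong) simp

lemma decidable_conj [recursive_intros]:
  assumes "decidable n P" and "decidable n Q"
  shows "decidable n (\<lambda>xs. P xs \<and> Q xs)"
  using computable_if[OF assms(1) assms(2)[unfolded decidable_def] computable_const[of n 0]]
  unfolding decidable_def by (rule computable_cong) simp

lemma decidable_disj [recursive_intros]: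
  assumes "decidable n P" and "decidable n Q"
  shows "decidable n (\<lambda>xs. P xs \<or> Q xs)"
  using computable_if[OF assms(1) computable_const[of n 1] assms(2)[unfolded decidable_def]]
  unfolding decidable_def by (rule computable_cong) simp

lemma decidable_imp [recursive_intros]:
  assumes "decidable n P" and "decidable n Q"
  shows "decidable n (\<lambda>xs. P xs \<longrightarrow> Q xs)"
  using computable_if[OF assms(1) assms(2)[unfolded decidable_def] computable_const[of n 1]]
  unfolding decidable_def by (rule computable_cong) simp

text \<open>
  A bounded search is a recursion whose step sees the counter, the accumulated result and then the
  parameters; this lemma lets a predicate of the counter and the parameters skip the result.
\<close>

lemma decidable_drop_second:
  assumes "decidable (Suc n) (\<lambda>zs. P (zs ! 0) (tl zs))"
  shows "decidable (Suc (Suc n)) (\<lambda>zs. P (zs ! 0) (tl (tl zs)))"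
proof -
  let ?gs = "(\<lambda>xs. xs ! 0) # map (\<lambda>i xs. xs ! (i + 2)) [0..<n]"
  have "computable (Suc (Suc n)) (\<lambda>xs. (\<lambda>zs. if P (zs ! 0) (tl zs) then 1 else 0) (map (\<lambda>g. g xs) ?gs))"
    using assms unfolding decidable_def by (intro computable_comp) (auto intro: computable_nth)
  then show ?thesis
    unfolding decidable_def
  proof (rule computable_cong)
    fix xs :: "nat list" assume "length xs = Suc (Suc n)"
    then have "map (\<lambda>i. xs ! (i + 2)) [0..<n] = tl (tl xs)"
      by (intro nth_equalityI) (auto simp: nth_tl)
    then have "map (\<lambda>g. g xs) ?gs = xs ! 0 # tl (tl xs)"
      by (simp add: comp_def)
    then show "(\<lambda>zs. if P (zs ! 0) (tl zs) then 1 else 0) (map (\<lambda>g. g xs) ?gs) =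
      (if P (xs ! 0) (tl (tl xs)) then 1 else (0::nat))" by simp
  qed
qed

lemma decidable_bex [recursive_intros]:
  assumes P: "decidable (Suc n) (\<lambda>zs. P (zs ! 0) (tl zs))" and b: "computable n b"
  shows "decidable n (\<lambda>xs. \<exists>y<b xs. P y xs)"
proof -
  have "computable n (\<lambda>xs. rec_nat 0 (\<lambda>k r. if P k xs then 1 else r) (b xs))"
    by (intro recursive_intros decidable_drop_second P b) auto
  moreover have "rec_nat 0 (\<lambda>k r. if Q k then 1 else r) m = (if \<exists>y<m. Q y then 1 else (0::nat))"
    for Q m
    by (induction m) (auto simp: less_Suc_eq)
  ultimately show ?thesis unfolding decidable_def by simp
qed

lemma decidable_ball [recursive_intros]:
  assumes "decidable (Suc n) (\<lambda>zs. P (zs ! 0) (tl zs))" and "computable n b"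
  shows "decidable n (\<lambda>xs. \<forall>y<b xs. P y xs)"
  using decidable_not[OF decidable_bex[OF decidable_not[OF assms(1)] assms(2)]] by simp

lemma computable_Least [recursive_intros]:
  assumes P: "decidable (Suc n) (\<lambda>zs. P (zs ! 0) (tl zs))"
    and ex: "\<And>xs. length xs = n \<Longrightarrow> \<exists>y. P y xs"
  shows "computable n (\<lambda>xs. LEAST y. P y xs)"
proof -
  have "computable (Suc n) (\<lambda>zs. if P (zs ! 0) (tl zs) then 0 else 1)"
    by (intro recursive_intros P)
  then obtain F where F: "recfn (Suc n) F"
    "\<And>zs. length zs = Suc n \<Longrightarrow> F zs = (if P (zs ! 0) (tl zs) then 0 else 1)"
    unfolding computable_def by blast
  then have *: "F (y # xs) = 0 \<longleftrightarrow> P y xs" if "length xs = n" for y xs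
    using that by auto
  show ?thesis
    unfolding computable_def
    by (intro exI[of _ "\<lambda>xs. LEAST y. F (y # xs) = 0"] conjI recfn.mu F(1)) (auto simp: * ex)
qed

lemma computable_add [recursive_intros]:
  assumes "computable n f" and "computable n g"
  shows "computable n (\<lambda>xs. f xs + g xs)"
proof (rule computable_comp2[OF _ assms])
  have "computable 2 (\<lambda>xs. rec_nat (xs ! 0) (\<lambda>k r. Suc r) (xs ! 1))"
    by (intro recursive_intros) auto
  moreover have "rec_nat a (\<lambda>k r. Suc r) b = a + b" for a b by (induction b) auto
  ultimately show "computable 2 (\<lambda>xs. xs ! 0 + xs ! 1)" by simp
qed

lemma computable_mult [recursive_intros]:
  assumes "computable n f" and "computable n g"
  shows "computable n (\<lambda>xs. f xs * g xs)"
proof (rule computable_comp2[OF _ assms])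
  have "computable 2 (\<lambda>xs. rec_nat 0 (\<lambda>k r. xs ! 0 + r) (xs ! 1))"
    by (intro recursive_intros) auto
  moreover have "rec_nat 0 (\<lambda>k r. a + r) b = a * b" for a b :: nat by (induction b) auto
  ultimately show "computable 2 (\<lambda>xs. xs ! 0 * xs ! 1)" by simp
qed

lemma computable_power2 [recursive_intros]:
  assumes "computable n f"
  shows "computable n (\<lambda>xs. 2 ^ f xs)"
proof (rule computable_comp1[OF _ assms])
  have "computable 1 (\<lambda>xs. rec_nat 1 (\<lambda>k r. 2 * r) (xs ! 0))"
    by (intro recursive_intros) auto
  moreover have "rec_nat 1 (\<lambda>k r. 2 * r) b = (2::nat) ^ b" for b by (induction b) auto
  ultimately show "computable 1 (\<lambda>xs. 2 ^ (xs ! 0))" by simp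
qed

lemma computable_pred [recursive_intros]:
  assumes "computable n f"
  shows "computable n (\<lambda>xs. f xs - 1)"
proof (rule computable_comp1[OF _ assms])
  have "computable 1 (\<lambda>xs. rec_nat 0 (\<lambda>k r. k) (xs ! 0))"
    by (intro recursive_intros) auto
  moreover have "rec_nat 0 (\<lambda>k r. k) b = b - 1" for b :: nat by (cases b) auto
  ultimately show "computable 1 (\<lambda>xs. xs ! 0 - 1)" by simp
qed

lemma decidable_eq [recursive_intros]:
  assumes "computable n f" and "computable n g"
  shows "decidable n (\<lambda>xs. f xs = g xs)"
proof (rule decidable_comp2[OF _ assms])
  let ?sub = "\<lambda>a b. rec_nat a (\<lambda>k r. r - 1) b"
  have sub: "?sub a b = a - b" for a b :: nat by (induction b) auto
  \<comment> \<open>numbers are equal iff both truncated differences vanish\<close>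
  have "computable 2 (\<lambda>xs. rec_nat 1 (\<lambda>k r. 0) (?sub (xs ! 0) (xs ! 1) + ?sub (xs ! 1) (xs ! 0)))"
    by (intro recursive_intros) auto
  moreover have "rec_nat 1 (\<lambda>k r. 0) ((a - b) + (b - a)) = (if a = b then 1 else (0::nat))"
    for a b :: nat
  proof (cases "(a - b) + (b - a)")
    case (Suc d)
    then have "a \<noteq> b" by auto
    then show ?thesis using Suc by simp
  qed auto
  ultimately show "decidable 2 (\<lambda>xs. xs ! 0 = xs ! 1)"
    unfolding decidable_def sub by simp
qed

lemma decidable_less [recursive_intros]:
  assumes "computable n f" and "computable n g"
  shows "decidable n (\<lambda>xs. f xs < g xs)"
proof (rule decidable_comp2[OF _ assms])
  have "decidable 2 (\<lambda>xs. \<exists>y<xs ! 1. y = xs ! 0)"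
    by (intro recursive_intros) auto
  then show "decidable 2 (\<lambda>xs. xs ! 0 < xs ! 1)" by simp
qed

lemma decidable_le [recursive_intros]:
  assumes "computable n f" and "computable n g"
  shows "decidable n (\<lambda>xs. f xs \<le> g xs)"
  using decidable_not[OF decidable_less[OF assms(2,1)]] by (simp add: not_less)

lemma computable_prod_encode [recursive_intros]:
  assumes "computable n f" and "computable n g"
  shows "computable n (\<lambda>xs. prod_encode (f xs, g xs))"
proof -
  have "computable 1 (\<lambda>xs. rec_nat 0 (\<lambda>k r. r + Suc k) (xs ! 0))"
    by (intro recursive_intros) auto
  moreover have "rec_nat 0 (\<lambda>k r. r + Suc k) m = triangle m" for m
    by (induction m) auto
  ultimately have "computable 1 (\<lambda>xs. triangle (xs ! 0))" by simp
  from computable_comp1[OF this] show ?thesis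
    unfolding prod_encode_def by (simp add: computable_add assms)
qed

definition fst_code :: "nat \<Rightarrow> nat" where
  "fst_code z = fst (prod_decode z)"

definition snd_code :: "nat \<Rightarrow> nat" where
  "snd_code z = snd (prod_decode z)"

lemma fst_code_encode [simp]: "fst_code (prod_encode (a, b)) = a"
  and snd_code_encode [simp]: "snd_code (prod_encode (a, b)) = b"
  by (simp_all add: fst_code_def snd_code_def)

lemma prod_encode_fst_snd_code [simp]: "prod_encode (fst_code z, snd_code z) = z"
  by (simp add: fst_code_def snd_code_def)

lemma fst_code_le: "fst_code z \<le> z" and snd_code_le: "snd_code z \<le> z"
  using le_prod_encode_1[of "fst_code z" "snd_code z"] le_prod_encode_2[of "snd_code z" "fst_code z"]
  by simp_all

lemma computable_fst_code [recursive_intros]: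
  assumes "computable n f"
  shows "computable n (\<lambda>xs. fst_code (f xs))"
proof (rule computable_comp1[OF _ assms])
  have eq: "(\<exists>b<Suc z. prod_encode (a, b) = z) \<longleftrightarrow> a = fst_code z" for a z
  proof
    assume "a = fst_code z"
    then show "\<exists>b<Suc z. prod_encode (a, b) = z"
      by (intro exI[of _ "snd_code z"]) (simp add: snd_code_le le_imp_less_Suc)
  qed auto
  have "computable 1 (\<lambda>xs. LEAST a. \<exists>b<Suc (xs ! 0). prod_encode (a, b) = xs ! 0)"
    by (intro recursive_intros) (auto simp: eq)
  moreover have "(LEAST a. a = z) = z" for z :: nat by (rule Least_equality) auto
  ultimately show "computable 1 (\<lambda>xs. fst_code (xs ! 0))" by (simp add: eq)
qed

lemma computable_snd_code [recursive_intros]: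
  assumes "computable n f"
  shows "computable n (\<lambda>xs. snd_code (f xs))"
proof (rule computable_comp1[OF _ assms])
  have eq: "(\<exists>a<Suc z. prod_encode (a, b) = z) \<longleftrightarrow> b = snd_code z" for b z
  proof
    assume "b = snd_code z"
    then show "\<exists>a<Suc z. prod_encode (a, b) = z"
      by (intro exI[of _ "fst_code z"]) (simp add: fst_code_le le_imp_less_Suc)
  qed auto
  have "computable 1 (\<lambda>xs. LEAST b. \<exists>a<Suc (xs ! 0). prod_encode (a, b) = xs ! 0)"
    by (intro recursive_intros) (auto simp: eq)
  moreover have "(LEAST a. a = z) = z" for z :: nat by (rule Least_equality) auto
  ultimately show "computable 1 (\<lambda>xs. snd_code (xs ! 0))" by (simp add: eq)
qed

lemma decidable_mem_set_decode [recursive_intros]: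
  assumes "computable n f" and "computable n g"
  shows "decidable n (\<lambda>xs. f xs \<in> set_decode (g xs))"
proof (rule decidable_comp2[OF _ assms])
  \<comment> \<open>the digit \<open>z\<close> of \<open>T\<close> is 1 iff the quotient of \<open>T\<close> by \<open>2 ^ z\<close> is an odd number \<open>2 * q + 1\<close>\<close>
  have eq: "z \<in> set_decode T \<longleftrightarrow> (\<exists>q<Suc T. \<exists>r<2 ^ z. T = (2 * q + 1) * 2 ^ z + r)" for z T :: nat
  proof
    assume "z \<in> set_decode T"
    then obtain q where q: "T div 2 ^ z = 2 * q + 1" by (auto simp: set_decode_def elim: oddE)
    then have "T = (2 * q + 1) * 2 ^ z + T mod 2 ^ z" by (metis div_mult_mod_eq)
    moreover have "q \<le> T div 2 ^ z" using q by simp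
    then have "q < Suc T" using div_le_dividend[of T "2 ^ z"] by linarith
    ultimately show "\<exists>q<Suc T. \<exists>r<2 ^ z. T = (2 * q + 1) * 2 ^ z + r"
      by (intro exI[of _ q] conjI exI[of _ "T mod 2 ^ z"]) auto
  next
    assume "\<exists>q<Suc T. \<exists>r<2 ^ z. T = (2 * q + 1) * 2 ^ z + r"
    then obtain q r where "r < 2 ^ z" "T = (2 * q + 1) * 2 ^ z + r" by blast
    then have "T div 2 ^ z = 2 * q + 1"
      using div_mult_self3[of "2 ^ z" "2 * q + 1" r] by simp
    then show "z \<in> set_decode T" by (simp add: set_decode_def)
  qed
  show "decidable 2 (\<lambda>xs. xs ! 0 \<in> set_decode (xs ! 1))"
    unfolding eq by (intro recursive_intros) auto
qed

text \<open>
  A nonempty list \<open>x # xs\<close> is coded by the successor of the code of the pair \<open>(x, list_encode xs)\<close>, so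
  that one step of this recursion takes a tail; 0 codes the empty list, which is its own tail.
\<close>

definition drop_code :: "nat \<Rightarrow> nat \<Rightarrow> nat" where
  "drop_code u i = rec_nat u (\<lambda>_ r. snd_code (r - 1)) i"

definition len_code :: "nat \<Rightarrow> nat" where
  "len_code u = (LEAST i. drop_code u i = 0)"

definition nth_code :: "nat \<Rightarrow> nat \<Rightarrow> nat" where
  "nth_code u i = fst_code (drop_code u i - 1)"

lemma drop_code_list_encode: "drop_code (list_encode xs) i = list_encode (drop i xs)"
proof (induction i)
  case (Suc i)
  show ?case
  proof (cases "drop i xs")
    case (Cons y ys)
    then have "drop (Suc i) xs = ys" by (simp add: drop_Suc tl_drop[symmetric])
    then show ?thesis using Suc Cons by (simp add: drop_code_def)
  next
    case Nil
    have "snd_code 0 = 0" using snd_code_le[of 0] by simp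
    then show ?thesis using Suc Nil by (simp add: drop_code_def)
  qed
qed (simp add: drop_code_def)

lemma list_encode_eq_0 [simp]: "list_encode xs = 0 \<longleftrightarrow> xs = []"
  by (cases xs) auto

lemma len_code_list_encode [simp]: "len_code (list_encode xs) = length xs"
  unfolding len_code_def by (rule Least_equality) (auto simp: drop_code_list_encode)

lemma nth_code_list_encode [simp]: "i < length xs \<Longrightarrow> nth_code (list_encode xs) i = xs ! i"
  by (simp add: nth_code_def drop_code_list_encode Cons_nth_drop_Suc[symmetric])

lemma computable_drop_code [recursive_intros]:
  assumes "computable n f" and "computable n g"
  shows "computable n (\<lambda>xs. drop_code (f xs) (g xs))"
proof (rule computable_comp2[OF _ assms])
  show "computable 2 (\<lambda>xs. drop_code (xs ! 0) (xs ! 1))"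
    unfolding drop_code_def by (intro recursive_intros) auto
qed

lemma computable_len_code [recursive_intros]:
  assumes "computable n f"
  shows "computable n (\<lambda>xs. len_code (f xs))"
proof (rule computable_comp1[OF _ assms])
  have "\<exists>i. drop_code u i = 0" for u
    using drop_code_list_encode[of "list_decode u" "length (list_decode u)"] by auto
  then show "computable 1 (\<lambda>xs. len_code (xs ! 0))"
    unfolding len_code_def by (intro recursive_intros) auto
qed

lemma computable_nth_code [recursive_intros]:
  assumes "computable n f" and "computable n g"
  shows "computable n (\<lambda>xs. nth_code (f xs) (g xs))"
  unfolding nth_code_def by (intro recursive_intros assms)

section \<open>Embeddings and forbidden substructures\<close>

text \<open>
  Isomorphic copies of substructures are handled as embeddings, which compose. All symbols are treated
  alike here, the language entering only through \<open>is_struct\<close>; the two structures may live on different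
  types, as finite presentations and the members of a class do.
\<close>

definition embedding :: "('b \<Rightarrow> 'a) \<Rightarrow> 'b fo_struct \<Rightarrow> 'a fo_struct \<Rightarrow> bool" where
  "embedding p B A \<longleftrightarrow> inj_on p (carrier B) \<and> p ` carrier B \<subseteq> carrier A \<and>
     (\<forall>k xs. set xs \<subseteq> carrier B \<longrightarrow> (xs \<in> rel B k \<longleftrightarrow> map p xs \<in> rel A k))"

lemma embedding_comp:
  assumes p: "embedding p B A" and q: "embedding q C B"
  shows "embedding (p \<circ> q) C A"
  unfolding embedding_def
proof (intro conjI allI impI)
  have sub: "q ` carrier C \<subseteq> carrier B" using q by (simp add: embedding_def)
  show "inj_on (p \<circ> q) (carrier C)"
    using p q sub by (auto simp: embedding_def intro: comp_inj_on inj_on_subset)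
  show "(p \<circ> q) ` carrier C \<subseteq> carrier A"
    using p sub by (auto simp: embedding_def)
  fix k xs assume xs: "set xs \<subseteq> carrier C"
  then have "set (map q xs) \<subseteq> carrier B" using sub by auto
  then have "map q xs \<in> rel B k \<longleftrightarrow> map p (map q xs) \<in> rel A k"
    using p unfolding embedding_def by blast
  then show "xs \<in> rel C k \<longleftrightarrow> map (p \<circ> q) xs \<in> rel A k"
    using q xs by (simp add: embedding_def)
qed

lemma embedding_cong:
  assumes "embedding p B A" and eq: "\<And>x. x \<in> carrier B \<Longrightarrow> p x = q x"
  shows "embedding q B A"
proof -
  have "map q xs = map p xs" if "set xs \<subseteq> carrier B" for xs
    using that eq by auto
  moreover have "inj_on q (carrier B) \<longleftrightarrow> inj_on p (carrier B)"
    using eq by (intro inj_on_cong) simp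
  moreover have "q ` carrier B = p ` carrier B"
    using eq by (intro image_cong) simp_all
  ultimately show ?thesis using assms(1) unfolding embedding_def by metis
qed

lemma isomorphic_sym:
  assumes "isomorphic L A B"
  shows "isomorphic L B A"
proof -
  obtain f where f: "bij_betw f (carrier A) (carrier B)"
    "\<And>k xs. k \<in> preds L \<Longrightarrow> length xs = arity L k \<Longrightarrow> set xs \<subseteq> carrier A \<Longrightarrow>
      xs \<in> rel A k \<longleftrightarrow> map f xs \<in> rel B k"
    using assms unfolding isomorphic_def by blast
  let ?g = "inv_into (carrier A) f"
  have "ys \<in> rel B k \<longleftrightarrow> map ?g ys \<in> rel A k"
    if "k \<in> preds L" "length ys = arity L k" "set ys \<subseteq> carrier B" for k ys
  proof -
    have "map f (map ?g ys) = ys"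
      using f(1) that(3) by (auto simp: bij_betw_inv_into_right intro!: map_idI)
    moreover have "set (map ?g ys) \<subseteq> carrier A"
      using bij_betw_inv_into[OF f(1)] that(3) by (auto simp: bij_betw_def)
    ultimately show ?thesis using f(2)[of k "map ?g ys"] that by simp
  qed
  then show ?thesis
    unfolding isomorphic_def using bij_betw_inv_into[OF f(1)] by blast
qed

lemma isomorphic_trans:
  assumes "isomorphic L A B" and "isomorphic L B C"
  shows "isomorphic L A C"
proof -
  obtain f where f: "bij_betw f (carrier A) (carrier B)"
    "\<And>k xs. k \<in> preds L \<Longrightarrow> length xs = arity L k \<Longrightarrow> set xs \<subseteq> carrier A \<Longrightarrow>
      xs \<in> rel A k \<longleftrightarrow> map f xs \<in> rel B k"
    using assms(1) unfolding isomorphic_def by blast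
  obtain g where g: "bij_betw g (carrier B) (carrier C)"
    "\<And>k xs. k \<in> preds L \<Longrightarrow> length xs = arity L k \<Longrightarrow> set xs \<subseteq> carrier B \<Longrightarrow>
      xs \<in> rel B k \<longleftrightarrow> map g xs \<in> rel C k"
    using assms(2) unfolding isomorphic_def by blast
  have "xs \<in> rel A k \<longleftrightarrow> map (g \<circ> f) xs \<in> rel C k"
    if "k \<in> preds L" "length xs = arity L k" "set xs \<subseteq> carrier A" for k xs
    using f(2)[of k xs] g(2)[of k "map f xs"] that f(1) by (auto simp: bij_betw_def)
  then show ?thesis
    unfolding isomorphic_def using bij_betw_trans[OF f(1) g(1)] by blast
qed

lemma rel_outside_empty:
  assumes "is_struct L A" and "\<not> (k \<in> preds L \<and> length xs = arity L k)"
  shows "xs \<notin> rel A k"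
  using assms by (auto simp: is_struct_def)

text \<open>
  Isomorphisms speak only about tuples of the right length for symbols of the language; for all other
  tuples both structures agree, since the relations contain none of them.
\<close>

lemma isomorphic_imp_embedding:
  assumes "isomorphic L B A" and B: "is_struct L B" and A: "is_struct L A"
  shows "\<exists>p. embedding p B A"
proof -
  obtain f where f: "bij_betw f (carrier B) (carrier A)"
    "\<And>k xs. k \<in> preds L \<Longrightarrow> length xs = arity L k \<Longrightarrow> set xs \<subseteq> carrier B \<Longrightarrow>
      xs \<in> rel B k \<longleftrightarrow> map f xs \<in> rel A k"
    using assms unfolding isomorphic_def by blast
  have "xs \<in> rel B k \<longleftrightarrow> map f xs \<in> rel A k" if "set xs \<subseteq> carrier B" for k xs
    using f(2)[OF _ _ that] rel_outside_empty[OF B, of k xs] rel_outside_empty[OF A, of k "map f xs"]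
    by auto
  then show ?thesis
    using f(1) unfolding embedding_def bij_betw_def by blast
qed

lemma embedding_iff_isomorphic_substructure:
  assumes A: "is_struct L A" and C: "is_struct L C"
  shows "(\<exists>p. embedding p C A) \<longleftrightarrow> (\<exists>B. substructure B A \<and> isomorphic L B C)"
proof
  assume "\<exists>p. embedding p C A"
  then obtain p where p: "embedding p C A" by blast
  define B where "B = \<lparr>carrier = p ` carrier C, rel = \<lambda>k. {xs \<in> rel A k. set xs \<subseteq> p ` carrier C}\<rparr>"
  have "substructure B A"
    using p C by (auto simp: substructure_def B_def embedding_def is_struct_def)
  moreover have "isomorphic L C B"
    unfolding isomorphic_def using p
    by (intro exI[of _ p]) (auto simp: B_def embedding_def bij_betw_def)
  ultimately show "\<exists>B. substructure B A \<and> isomorphic L B C"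
    using isomorphic_sym by blast
next
  assume "\<exists>B. substructure B A \<and> isomorphic L B C"
  then obtain B where B: "substructure B A" "isomorphic L B C" by blast
  then have "is_struct L B" using A by (auto simp: is_struct_def substructure_def)
  then obtain p where p: "embedding p C B"
    using isomorphic_imp_embedding[OF isomorphic_sym[OF B(2)] C] by blast
  moreover have "embedding (\<lambda>x. x) B A"
    using B(1) by (auto simp: substructure_def embedding_def)
  ultimately show "\<exists>p. embedding p C A" using embedding_comp by blast
qed

definition omits :: "'a fo_struct set \<Rightarrow> 'b fo_struct \<Rightarrow> bool" where
  "omits H A \<longleftrightarrow> \<not> (\<exists>C\<in>H. \<exists>p. embedding p C A)"

text \<open>
  Membership in \<open>Forb L H\<close> becomes a condition that makes sense for structures over any type, so that it
  can be transferred between a class over \<open>'a\<close> and finite presentations over the natural numbers.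
\<close>

lemma Forb_iff_omits:
  assumes "\<forall>C\<in>H. is_struct L C"
  shows "A \<in> Forb L H \<longleftrightarrow> is_struct L A \<and> omits H A"
proof (cases "is_struct L A")
  case True
  then have "(\<exists>p. embedding p C A) \<longleftrightarrow> (\<exists>B. substructure B A \<and> isomorphic L B C)" if "C \<in> H" for C
    using assms that embedding_iff_isomorphic_substructure by blast
  then show ?thesis unfolding Forb_def omits_def by blast
qed (simp add: Forb_def)

lemma omits_embedding: "omits H A \<Longrightarrow> embedding p B A \<Longrightarrow> omits H B"
  unfolding omits_def using embedding_comp by blast

text \<open>
  The structure induced on an index set \<open>S\<close> by naming elements of \<open>A\<close>. With injective \<open>p\<close> it gives
  copies of substructures of \<open>A\<close> on a carrier of choice.
\<close>

definition pullback :: "('b \<Rightarrow> 'a) \<Rightarrow> 'b set \<Rightarrow> 'a fo_struct \<Rightarrow> 'b fo_struct" where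
  "pullback p S A = \<lparr>carrier = S, rel = \<lambda>k. {xs. set xs \<subseteq> S \<and> map p xs \<in> rel A k}\<rparr>"

lemma is_struct_pullback:
  assumes "is_struct L A" and "S \<noteq> {}"
  shows "is_struct L (pullback p S A)"
  unfolding is_struct_def
proof (intro conjI ballI allI impI)
  fix k xs assume k: "k \<in> preds L" and xs: "xs \<in> rel (pullback p S A) k"
  then have *: "set xs \<subseteq> S" "map p xs \<in> rel A k" by (auto simp: pullback_def)
  then have "length (map p xs) = arity L k"
    using assms(1) k unfolding is_struct_def by blast
  then show "length xs = arity L k" by simp
  show "set xs \<subseteq> carrier (pullback p S A)" using * by (simp add: pullback_def)
  assume "nfin L < k"
  then have "distinct (map p xs)" using * k assms(1) by (simp add: is_struct_def)
  then show "distinct xs" by (simp add: distinct_map)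
qed (use assms in \<open>auto simp: pullback_def is_struct_def\<close>)

lemma embedding_pullback:
  assumes "inj_on p S" and "p ` S \<subseteq> carrier A"
  shows "embedding p (pullback p S A) A"
  using assms by (auto simp: embedding_def pullback_def)

lemma isomorphic_finite_presentation:
  assumes C: "is_struct L C" and "finite (carrier C)"
  obtains B where "B \<in> finite_presentations L" and "isomorphic L C B"
proof -
  let ?n = "card (carrier C)"
  obtain p where p: "bij_betw p {..<?n} (carrier C)"
    using ex_bij_betw_nat_finite[OF assms(2)] by (auto simp: atLeast0LessThan)
  define B where "B = pullback p {..<?n} C"
  have "{..<?n} \<noteq> {}" using assms by (auto simp: is_struct_def lessThan_empty_iff)
  then have "is_struct L B" unfolding B_def using C by (intro is_struct_pullback)
  moreover have B: "carrier B = {..<?n}" by (simp add: B_def pullback_def)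
  moreover have "isomorphic L B C"
    unfolding isomorphic_def using p by (intro exI[of _ p]) (auto simp: B_def pullback_def)
  moreover from calculation have "B \<in> finite_presentations L"
    by (auto simp: finite_presentations_def)
  ultimately show thesis
    using that[OF _ isomorphic_sym] by simp
qed

section \<open>Universal sentences and finite countermodels\<close>

text \<open>
  Quantifiers are skipped. As validity in a structure already quantifies over all assignments, the leading
  quantifiers of a universal sentence may be dropped, and the sentence and its matrix are evaluated by the
  same recursion.
\<close>

primrec matrix_sat :: "'a fo_struct \<Rightarrow> (nat \<Rightarrow> 'a) \<Rightarrow> fm \<Rightarrow> bool" where
  "matrix_sat A e (Equal i j) \<longleftrightarrow> e i = e j"
| "matrix_sat A e (Atom k vs) \<longleftrightarrow> map e vs \<in> rel A k"
| "matrix_sat A e (Neg \<phi>) \<longleftrightarrow> \<not> matrix_sat A e \<phi>"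
| "matrix_sat A e (Conj \<phi> \<psi>) \<longleftrightarrow> matrix_sat A e \<phi> \<and> matrix_sat A e \<psi>"
| "matrix_sat A e (Forall i \<phi>) \<longleftrightarrow> matrix_sat A e \<phi>"

lemma models_Forall:
  assumes "carrier A \<noteq> {}"
  shows "models A (Forall i \<phi>) \<longleftrightarrow> models A \<phi>"
proof
  assume all: "models A (Forall i \<phi>)"
  show "models A \<phi>"
    unfolding models_def
  proof (intro allI impI)
    fix e :: "nat \<Rightarrow> _" assume e: "range e \<subseteq> carrier A"
    then have "sat A (e(i := e i)) \<phi>"
      using all unfolding models_def by (auto simp del: fun_upd_triv)
    then show "sat A e \<phi>" by simp
  qed
next
  assume "models A \<phi>"
  moreover have "range (e(i := a)) \<subseteq> carrier A" if "range e \<subseteq> carrier A" "a \<in> carrier A" for e :: "nat \<Rightarrow> _" and a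
    using that by auto
  ultimately show "models A (Forall i \<phi>)" unfolding models_def by auto
qed

lemma models_universal_sentence:
  assumes "universal_sentence L \<phi>" and A: "carrier A \<noteq> {}"
  shows "models A \<phi> \<longleftrightarrow> (\<forall>e. range e \<subseteq> carrier A \<longrightarrow> matrix_sat A e \<phi>)"
proof -
  obtain vs \<psi> where \<phi>: "\<phi> = foldr Forall vs \<psi>" and qf: "quantifier_free \<psi>"
    using assms(1) unfolding universal_sentence_def by blast
  have "models A (foldr Forall vs \<psi>) \<longleftrightarrow> models A \<psi>"
    by (induction vs) (simp_all add: models_Forall A)
  moreover have "matrix_sat A e (foldr Forall vs \<psi>) \<longleftrightarrow> matrix_sat A e \<psi>" for e
    by (induction vs) simp_all
  moreover have "matrix_sat A e \<psi> \<longleftrightarrow> sat A e \<psi>" for e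
    using qf by (induction \<psi>) simp_all
  ultimately show ?thesis unfolding \<phi> by (simp add: models_def)
qed

lemma matrix_sat_embedding:
  assumes "embedding p B A" and "range e \<subseteq> carrier B"
  shows "matrix_sat B e \<phi> \<longleftrightarrow> matrix_sat A (p \<circ> e) \<phi>"
proof (induction \<phi>)
  case (Equal i j)
  have "e i \<in> carrier B" "e j \<in> carrier B" using assms(2) by auto
  then have "p (e i) = p (e j) \<longleftrightarrow> e i = e j"
    using assms(1) unfolding embedding_def by (metis inj_on_eq_iff)
  then show ?case by simp
next
  case (Atom k vs)
  have "set (map e vs) \<subseteq> carrier B" using assms(2) by auto
  then have "map e vs \<in> rel B k \<longleftrightarrow> map p (map e vs) \<in> rel A k"
    using assms(1) unfolding embedding_def by blast
  then show ?case by (simp add: comp_def)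
qed simp_all

lemma models_embedding:
  assumes "universal_sentence L \<phi>" and "embedding p B A" and "carrier B \<noteq> {}" and "models A \<phi>"
  shows "models B \<phi>"
proof -
  have sub: "p ` carrier B \<subseteq> carrier A" using assms(2) by (simp add: embedding_def)
  then have "carrier A \<noteq> {}" using assms(3) by auto
  note A = models_universal_sentence[OF assms(1) this]
  show ?thesis
    unfolding models_universal_sentence[OF assms(1,3)]
  proof (intro allI impI)
    fix e :: "nat \<Rightarrow> _" assume e: "range e \<subseteq> carrier B"
    then have "range (p \<circ> e) \<subseteq> carrier A" using sub by auto
    then show "matrix_sat B e \<phi>"
      using matrix_sat_embedding[OF assms(2) e] A assms(4) by simp
  qed
qed

lemma le_list_encode: "x \<in> set xs \<Longrightarrow> x \<le> list_encode xs"
proof (induction xs)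
  case (Cons y ys)
  then show ?case
    using le_prod_encode_1[of y "list_encode ys"] le_prod_encode_2[of "list_encode ys" y] by auto
qed simp

lemma fm_code_subformula:
  "fm_code \<phi> < fm_code (Neg \<phi>)"
  "fm_code \<phi> < fm_code (Conj \<phi> \<psi>)"
  "fm_code \<psi> < fm_code (Conj \<phi> \<psi>)"
  "fm_code \<phi> < fm_code (Forall i \<phi>)"
proof -
  have less: "b < prod_encode (a, b)" if "0 < a" for a b
  proof -
    have "b \<le> triangle b" for b by (induction b) simp_all
    then have "a + b \<le> triangle (a + b)" .
    then show ?thesis using that by (simp add: prod_encode_def)
  qed
  show "fm_code \<phi> < fm_code (Neg \<phi>)" by (simp add: less)
  show "fm_code \<phi> < fm_code (Conj \<phi> \<psi>)" "fm_code \<psi> < fm_code (Conj \<phi> \<psi>)"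
    using le_prod_encode_1[of "fm_code \<phi>" "fm_code \<psi>"] le_prod_encode_2[of "fm_code \<psi>" "fm_code \<phi>"]
      less[of 3 "prod_encode (fm_code \<phi>, fm_code \<psi>)"] by simp_all
  show "fm_code \<phi> < fm_code (Forall i \<phi>)"
    using le_prod_encode_2[of "fm_code \<phi>" i] less[of 4 "prod_encode (i, fm_code \<phi>)"] by simp
qed

text \<open>
  The code of a formula is at least as large as each of its variables, which yields a computable bound on
  the part of an assignment that matters.
\<close>

lemma matrix_sat_cong:
  "(\<And>i. i \<le> fm_code \<phi> \<Longrightarrow> e i = e' i) \<Longrightarrow> matrix_sat A e \<phi> \<longleftrightarrow> matrix_sat A e' \<phi>"
proof (induction \<phi>)
  case (Equal i j)
  have "i \<le> fm_code (Equal i j)" "j \<le> fm_code (Equal i j)"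
    using le_prod_encode_1[of i j] le_prod_encode_2[of j i]
      le_prod_encode_2[of "prod_encode (i, j)" 0]
    by simp_all
  then show ?case using Equal by simp
next
  case (Atom k vs)
  have "v \<le> fm_code (Atom k vs)" if "v \<in> set vs" for v
    using le_list_encode[OF that] le_prod_encode_2[of "list_encode vs" k]
      le_prod_encode_2[of "prod_encode (k, list_encode vs)" 1] by simp
  then have "map e vs = map e' vs" using Atom by simp
  then show ?case by (simp only: matrix_sat.simps)
next
  case (Neg \<phi>)
  then show ?case using fm_code_subformula(1)[of \<phi>] by (simp del: fm_code.simps)
next
  case (Conj \<phi> \<psi>)
  then show ?case using fm_code_subformula(2,3)[of \<phi> \<psi>] fm_code_subformula(3)[of \<psi> \<phi>] 
    by (simp del: fm_code.simps)
next
  case (Forall i \<phi>)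
  then show ?case using fm_code_subformula(4)[of \<phi> i] by (simp del: fm_code.simps)
qed

text \<open>
  A failing assignment uses only the variables up to \<open>fm_code \<phi>\<close>; their values form a finite
  substructure in which the matrix still fails.
\<close>

lemma finite_countermodel:
  assumes \<phi>: "universal_sentence L \<phi>" and A: "is_struct L A" and "\<not> models A \<phi>"
  obtains B p where "B \<in> finite_presentations L" and "card (carrier B) \<le> Suc (fm_code \<phi>)"
    and "embedding p B A" and "\<not> models B \<phi>"
proof -
  let ?x = "fm_code \<phi>"
  have ne: "carrier A \<noteq> {}" using A by (simp add: is_struct_def)
  obtain e where e: "range e \<subseteq> carrier A" "\<not> matrix_sat A e \<phi>"
    using assms(3) unfolding models_universal_sentence[OF \<phi> ne] by auto
  \<comment> \<open>\<open>e\<close> with values confined to the finite set \<open>S\<close>, unchanged on the variables of the sentence\<close>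
  define e' where "e' = (\<lambda>i. e (min i ?x))"
  define S where "S = e ` {..?x}"
  have range_e': "range e' \<subseteq> S" by (auto simp: e'_def S_def)
  have "finite S" "S \<noteq> {}" "S \<subseteq> carrier A" using e(1) by (auto simp: S_def)
  have "card S \<le> Suc ?x" unfolding S_def using card_image_le[of "{..?x}" e] by simp
  obtain p where p: "bij_betw p {..<card S} S"
    using ex_bij_betw_nat_finite[OF \<open>finite S\<close>] by (auto simp: atLeast0LessThan)
  define B where "B = pullback p {..<card S} A"
  have "{..<card S} \<noteq> {}" using \<open>finite S\<close> \<open>S \<noteq> {}\<close> by (simp add: lessThan_empty_iff)
  then have "is_struct L B" unfolding B_def using A by (rule is_struct_pullback[rotated])
  have carrier_B: "carrier B = {..<card S}" by (simp add: B_def pullback_def)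
  have emb: "embedding p B A"
    unfolding B_def using p \<open>S \<subseteq> carrier A\<close> by (intro embedding_pullback) (auto simp: bij_betw_def)
  define d where "d = (\<lambda>i. inv_into {..<card S} p (e' i))"
  have range_d: "range d \<subseteq> carrier B"
    using bij_betw_inv_into[OF p] range_e' unfolding d_def carrier_B by (auto simp: bij_betw_def)
  have "p \<circ> d = e'"
    using bij_betw_inv_into_right[OF p] range_e' by (auto simp: d_def fun_eq_iff)
  moreover have "\<not> matrix_sat A e' \<phi>"
    using e(2) matrix_sat_cong[of \<phi> e e' A] by (simp add: e'_def)
  ultimately have not_sat: "\<not> matrix_sat B d \<phi>"
    using matrix_sat_embedding[OF emb range_d] by simp
  have "carrier B \<noteq> {}" using \<open>is_struct L B\<close> by (simp add: is_struct_def)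
  note B = models_universal_sentence[OF \<phi> this]
  have "\<not> models B \<phi>"
    unfolding B using range_d not_sat by auto
  moreover have "B \<in> finite_presentations L"
    using \<open>is_struct L B\<close> carrier_B by (auto simp: finite_presentations_def)
  moreover have "card (carrier B) \<le> Suc ?x" using \<open>card S \<le> Suc ?x\<close> by (simp add: carrier_B)
  ultimately show thesis using that emb by blast
qed

text \<open>
  Transports a presentation along an injection of the natural numbers into \<open>'a\<close>. Embeddings in both
  directions transfer universal sentences and the omission of \<open>H\<close> both ways.
\<close>

lemma embeddable_in_infinite_type:
  assumes "infinite (UNIV :: 'a set)" and B: "is_struct L (B :: nat fo_struct)"
  obtains A :: "'a fo_struct" and p q where "is_struct L A" and "embedding p B A" and "embedding q A B"
proof -
  obtain f :: "nat \<Rightarrow> 'a" where f: "inj f"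
    using infinite_countable_subset[OF assms(1)] by blast
  define A where "A = pullback (inv f) (f ` carrier B) B"
  have "carrier B \<noteq> {}" using B by (simp add: is_struct_def)
  then have "is_struct L A"
    unfolding A_def using B by (intro is_struct_pullback) auto
  moreover have "embedding (inv f) A B"
    unfolding A_def using f by (intro embedding_pullback) (auto simp: inj_on_def)
  moreover have "embedding f B A"
    using f by (auto simp: embedding_def A_def pullback_def intro: inj_on_subset)
  ultimately show thesis using that by blast
qed

text \<open>
  The reduction to finitely many finite structures. A countermodel in the class shrinks to a finite one,
  which still omits \<open>H\<close> because omission passes to embedded structures. Conversely a finite countermodel
  that omits \<open>H\<close> has a copy over the infinite type \<open>'a\<close>, which belongs to the class.
\<close>

lemma universal_theory_Forb_iff:
  fixes H :: "'a fo_struct set"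
  assumes inf: "infinite (UNIV :: 'a set)" and H: "\<forall>C\<in>H. is_struct L C"
    and \<phi>: "universal_sentence L \<phi>"
  shows "\<phi> \<in> universal_theory L (Forb L H) \<longleftrightarrow>
    (\<forall>B\<in>finite_presentations L. card (carrier B) \<le> Suc (fm_code \<phi>) \<and> omits H B \<longrightarrow> models B \<phi>)"
proof
  assume th: "\<phi> \<in> universal_theory L (Forb L H)"
  show "\<forall>B\<in>finite_presentations L. card (carrier B) \<le> Suc (fm_code \<phi>) \<and> omits H B \<longrightarrow> models B \<phi>"
  proof (intro ballI impI)
    fix B assume "B \<in> finite_presentations L" and om: "card (carrier B) \<le> Suc (fm_code \<phi>) \<and> omits H B"
    then have B: "is_struct L B" by (simp add: finite_presentations_def)
    obtain A :: "'a fo_struct" and p q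
      where A: "is_struct L A" "embedding p B A" "embedding q A B"
      using embeddable_in_infinite_type[OF inf B] by blast
    then have "A \<in> Forb L H"
      using om omits_embedding Forb_iff_omits[OF H] by blast
    then have "models A \<phi>" using th by (simp add: universal_theory_def)
    then show "models B \<phi>"
      using models_embedding[OF \<phi> A(2)] B by (simp add: is_struct_def)
  qed
next
  assume fin: "\<forall>B\<in>finite_presentations L. card (carrier B) \<le> Suc (fm_code \<phi>) \<and> omits H B \<longrightarrow> models B \<phi>"
  have "models A \<phi>" if "A \<in> Forb L H" for A
  proof (rule ccontr)
    have A: "is_struct L A" "omits H A" using that Forb_iff_omits[OF H] by auto
    assume "\<not> models A \<phi>"
    then obtain B p where "B \<in> finite_presentations L" "card (carrier B) \<le> Suc (fm_code \<phi>)"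
      "embedding p B A" "\<not> models B \<phi>"
      using finite_countermodel[OF \<phi> A(1)] by blast
    then show False using fin omits_embedding[OF A(2)] by blast
  qed
  then show "\<phi> \<in> universal_theory L (Forb L H)"
    using \<phi> by (simp add: universal_theory_def)
qed

section \<open>Arithmetization of finite structures and embeddings\<close>

text \<open>
  The inverse of \<open>struct_code\<close>: every number \<open>F\<close> is read as a finite set of facts. Not all \<open>F\<close> respect the
  arities and the non-repetition of a language.
\<close>

definition structure_of :: "nat \<Rightarrow> nat \<Rightarrow> nat fo_struct" where
  "structure_of m F =
     \<lparr>carrier = {..<m}, rel = \<lambda>k. {xs. prod_encode (k, list_encode xs) \<in> set_decode F}\<rparr>"

lemma carrier_structure_of [simp]: "carrier (structure_of m F) = {..<m}"
  by (simp add: structure_of_def)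

lemma rel_structure_of [simp]:
  "xs \<in> rel (structure_of m F) k \<longleftrightarrow> prod_encode (k, list_encode xs) \<in> set_decode F"
  by (simp add: structure_of_def)

lemma mem_set_decode_less: "z \<in> set_decode F \<Longrightarrow> z < F"
proof -
  assume "z \<in> set_decode F"
  then have "0 < F div 2 ^ z" by (auto simp: set_decode_def intro: Nat.gr0I)
  then have "2 ^ z \<le> F" by (simp add: div_greater_zero_iff)
  then show "z < F" using less_exp[of z] by linarith
qed

lemma fact_code_cases:
  obtains k xs where "z = prod_encode (k, list_encode xs)"
  using prod_encode_fst_snd_code[of z] list_decode_inverse[of "snd_code z"] by metis

text \<open>
  Elements of a set are smaller than its code, so that the bounded quantifiers used in arithmetical
  definitions range over all facts.
\<close>

lemma all_facts:
  "(\<forall>z<F. z \<in> set_decode F \<longrightarrow> P z) \<longleftrightarrow>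
    (\<forall>k xs. prod_encode (k, list_encode xs) \<in> set_decode F \<longrightarrow> P (prod_encode (k, list_encode xs)))"
  by (metis fact_code_cases mem_set_decode_less)

lemma ex_facts:
  "(\<exists>z<F. z \<in> set_decode F \<and> P z) \<longleftrightarrow>
    (\<exists>k xs. prod_encode (k, list_encode xs) \<in> set_decode F \<and> P (prod_encode (k, list_encode xs)))"
  by (metis fact_code_cases mem_set_decode_less)

definition codes_structure :: "lang \<Rightarrow> nat \<Rightarrow> nat \<Rightarrow> bool" where
  "codes_structure L m F \<longleftrightarrow> 0 < m \<and> (\<forall>z<F. z \<in> set_decode F \<longrightarrow>
     fst_code z \<in> preds L \<and> arity L (fst_code z) = len_code (snd_code z) \<and>
     (\<forall>i<len_code (snd_code z). nth_code (snd_code z) i < m) \<and>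
     (nfin L < fst_code z \<longrightarrow> (\<forall>i<len_code (snd_code z). \<forall>j<i.
        nth_code (snd_code z) j \<noteq> nth_code (snd_code z) i)))"

lemma distinct_conv_nth_less: "distinct xs \<longleftrightarrow> (\<forall>i<length xs. \<forall>j<i. xs ! j \<noteq> xs ! i)"
proof
  assume less: "\<forall>i<length xs. \<forall>j<i. xs ! j \<noteq> xs ! i"
  have "xs ! i \<noteq> xs ! j" if "i < length xs" "j < length xs" "i \<noteq> j" for i j
    using that less by (cases i j rule: linorder_cases) force+
  then show "distinct xs" by (simp add: distinct_conv_nth)
qed (auto simp: distinct_conv_nth)

lemma codes_structure_iff:
  "codes_structure L m F \<longleftrightarrow> is_struct L (structure_of m F)"
proof -
  have entries: "set xs \<subseteq> {..<m} \<longleftrightarrow> (\<forall>i<length xs. xs ! i < m)" for xs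
    by (force simp: subset_eq in_set_conv_nth)
  have "codes_structure L m F \<longleftrightarrow> 0 < m \<and> (\<forall>k xs. prod_encode (k, list_encode xs) \<in> set_decode F \<longrightarrow>
      k \<in> preds L \<and> arity L k = length xs \<and> set xs \<subseteq> {..<m} \<and> (nfin L < k \<longrightarrow> distinct xs))"
    unfolding codes_structure_def all_facts
    by (simp add: distinct_conv_nth_less entries cong: conj_cong imp_cong)
  also have "\<dots> \<longleftrightarrow> is_struct L (structure_of m F)"
  proof -
    have ne: "{..<m} \<noteq> {} \<longleftrightarrow> 0 < m" by (auto simp: lessThan_empty_iff)
    have empty: "rel (structure_of m F) k = {} \<longleftrightarrow>
      (\<forall>xs. prod_encode (k, list_encode xs) \<notin> set_decode F)" for k
      by (simp add: structure_of_def)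
    show ?thesis
      unfolding is_struct_def carrier_structure_of ne empty Ball_def rel_structure_of
      by (intro conj_cong refl iffI conjI allI impI; metis)
  qed
  finally show ?thesis .
qed

lemma diagram_structure_of:
  "(\<lambda>(k, xs). prod_encode (k, list_encode xs)) ` diagram (structure_of m F) = set_decode F"
proof (intro set_eqI iffI)
  fix z assume "z \<in> set_decode F"
  then show "z \<in> (\<lambda>(k, xs). prod_encode (k, list_encode xs)) ` diagram (structure_of m F)"
    by (cases z rule: fact_code_cases) (force simp: diagram_def)
qed (auto simp: diagram_def)

lemma struct_code_structure_of: "struct_code (structure_of m F) = prod_encode (m, F)"
  by (simp add: struct_code_def diagram_structure_of)

lemma structure_of_finite_presentation:
  "codes_structure L m F \<Longrightarrow> structure_of m F \<in> finite_presentations L"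
  by (auto simp: codes_structure_iff finite_presentations_def)

text \<open>
  Here the finiteness of the diagram is essential: it is what allows the diagram to be coded by a number.
\<close>

lemma finite_presentation_cases:
  assumes L: "finite_type L \<or> infinite_type L" and A: "A \<in> finite_presentations L"
  obtains F where "A = structure_of (card (carrier A)) F" and "codes_structure L (card (carrier A)) F"
proof -
  let ?h = "\<lambda>(k, xs). prod_encode (k, list_encode xs)"
  let ?F = "set_encode (?h ` diagram A)"
  obtain n where n: "carrier A = {..<n}" and st: "is_struct L A"
    using A by (auto simp: finite_presentations_def)
  then have "finite (diagram A)" using finite_diagram[OF L st] by simp
  then have decode: "set_decode ?F = ?h ` diagram A" by simp
  have "prod_encode (k, list_encode xs) \<in> ?h ` diagram A \<longleftrightarrow> xs \<in> rel A k" for k xs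
    by (auto simp: diagram_def list_encode_eq)
  then have "rel (structure_of n ?F) = rel A"
    by (auto simp: fun_eq_iff set_eq_iff decode)
  then have "A = structure_of n ?F" using n by (simp add: structure_of_def)
  moreover have "card (carrier A) = n" using n by simp
  ultimately show thesis using that[of ?F] st by (simp add: codes_structure_iff)
qed

text \<open>
  \<open>h\<close> codes a function on an initial segment, given as the list of its values.
\<close>

definition maps_code :: "nat \<Rightarrow> nat \<Rightarrow> nat \<Rightarrow> bool" where
  "maps_code h u v \<longleftrightarrow> len_code u = len_code v \<and>
     (\<forall>i<len_code u. nth_code v i = nth_code h (nth_code u i))"

lemma maps_code_list_encode:
  assumes "\<And>i. i \<in> set us \<Longrightarrow> i < length hs"
  shows "maps_code (list_encode hs) (list_encode us) (list_encode vs) \<longleftrightarrow> vs = map ((!) hs) us"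
  using assms by (auto simp: maps_code_def list_eq_iff_nth_eq)

text \<open>
  Preservation of relations by \<open>h\<close> quantifies over the facts of the two structures only, not over tuples of
  elements: each fact of \<open>G\<close> is mapped to a fact of \<open>F\<close>, and each fact of \<open>F\<close> about elements in the range
  of \<open>h\<close> comes from a fact of \<open>G\<close>.
\<close>

definition codes_embedding :: "nat \<Rightarrow> nat \<Rightarrow> nat \<Rightarrow> nat \<Rightarrow> nat \<Rightarrow> bool" where
  "codes_embedding n G m F h \<longleftrightarrow> len_code h = n \<and> (\<forall>i<n. nth_code h i < m) \<and>
     (\<forall>i<n. \<forall>j<i. nth_code h j \<noteq> nth_code h i) \<and>
     (\<forall>z<G. z \<in> set_decode G \<longrightarrow> (\<exists>w<F. w \<in> set_decode F \<and>
        fst_code z = fst_code w \<and> maps_code h (snd_code z) (snd_code w))) \<and>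
     (\<forall>w<F. w \<in> set_decode F \<longrightarrow>
        (\<forall>i<len_code (snd_code w). \<exists>j<n. nth_code (snd_code w) i = nth_code h j) \<longrightarrow>
        (\<exists>z<G. z \<in> set_decode G \<and> fst_code z = fst_code w \<and> maps_code h (snd_code z) (snd_code w)))"

lemma codes_embedding_iff:
  assumes G: "codes_structure L n G"
  shows "codes_embedding n G m F (list_encode hs) \<longleftrightarrow>
    length hs = n \<and> embedding ((!) hs) (structure_of n G) (structure_of m F)"
proof (cases "length hs = n")
  case len: True
  let ?G = "\<lambda>k xs. prod_encode (k, list_encode xs) \<in> set_decode G"
  let ?F = "\<lambda>k xs. prod_encode (k, list_encode xs) \<in> set_decode F"
  have G_sub: "set xs \<subseteq> {..<n}" if "?G k xs" for k xs
    using G that unfolding codes_structure_iff is_struct_def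
    by (metis carrier_structure_of empty_iff rel_structure_of)
  have maps: "maps_code (list_encode hs) (list_encode us) (list_encode vs) \<longleftrightarrow> vs = map ((!) hs) us"
    if "set us \<subseteq> {..<n}" for us vs
    using that len by (intro maps_code_list_encode) auto
  have in_range: "(\<forall>i<length ys. \<exists>j<n. ys ! i = nth_code (list_encode hs) j) \<longleftrightarrow>
      (\<exists>xs. set xs \<subseteq> {..<n} \<and> ys = map ((!) hs) xs)" for ys
  proof
    assume "\<forall>i<length ys. \<exists>j<n. ys ! i = nth_code (list_encode hs) j"
    then have "\<forall>i<length ys. \<exists>j<n. ys ! i = hs ! j"
      using len by (metis nth_code_list_encode)
    then obtain f where f: "\<And>i. i < length ys \<Longrightarrow> f i < n \<and> ys ! i = hs ! f i" by metis
    then have "ys = map ((!) hs) (map f [0..<length ys])"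
      by (intro nth_equalityI) auto
    moreover have "set (map f [0..<length ys]) \<subseteq> {..<n}" using f by auto
    ultimately show "\<exists>xs. set xs \<subseteq> {..<n} \<and> ys = map ((!) hs) xs" by blast
  next
    assume "\<exists>xs. set xs \<subseteq> {..<n} \<and> ys = map ((!) hs) xs"
    then obtain xs where xs: "set xs \<subseteq> {..<n}" "ys = map ((!) hs) xs" by blast
    then have "xs ! i < n" if "i < length ys" for i
      using that nth_mem[of i xs] by (auto simp: subset_eq)
    then show "\<forall>i<length ys. \<exists>j<n. ys ! i = nth_code (list_encode hs) j"
      using xs(2) len by (metis length_map nth_code_list_encode nth_map)
  qed
  have dist: "(\<forall>i<n. \<forall>j<i. nth_code (list_encode hs) j \<noteq> nth_code (list_encode hs) i) \<longleftrightarrow>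
      inj_on ((!) hs) {..<n}"
    using len distinct_conv_nth_less[of hs] inj_on_nth[of hs "{..<n}"]
    by (auto simp: distinct_conv_nth inj_on_def)
  have "codes_embedding n G m F (list_encode hs) \<longleftrightarrow>
    (\<forall>i<n. nth_code (list_encode hs) i < m) \<and> inj_on ((!) hs) {..<n} \<and>
      (\<forall>k xs. ?G k xs \<longrightarrow> (\<exists>k' ys. ?F k' ys \<and> k = k' \<and> maps_code (list_encode hs) (list_encode xs) (list_encode ys))) \<and>
      (\<forall>k ys. ?F k ys \<longrightarrow> (\<exists>xs. set xs \<subseteq> {..<n} \<and> ys = map ((!) hs) xs) \<longrightarrow>
      (\<exists>k' xs. ?G k' xs \<and> k' = k \<and> maps_code (list_encode hs) (list_encode xs) (list_encode ys)))"
    unfolding codes_embedding_def all_facts ex_facts dist fst_code_encode snd_code_encode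
      len_code_list_encode in_range[symmetric] using len
    by (simp cong: conj_cong imp_cong)
  also have "\<dots> \<longleftrightarrow> (\<forall>i<n. hs ! i < m) \<and> inj_on ((!) hs) {..<n} \<and>
      (\<forall>k xs. ?G k xs \<longrightarrow> ?F k (map ((!) hs) xs)) \<and>
      (\<forall>k ys. ?F k ys \<longrightarrow> (\<exists>xs. set xs \<subseteq> {..<n} \<and> ys = map ((!) hs) xs) \<longrightarrow>
      (\<exists>xs. ?G k xs \<and> ys = map ((!) hs) xs))"
  proof -
    have "(\<forall>i<n. nth_code (list_encode hs) i < m) \<longleftrightarrow> (\<forall>i<n. hs ! i < m)" using len by auto
    moreover have "(\<exists>k' ys. ?F k' ys \<and> k = k' \<and> maps_code (list_encode hs) (list_encode xs) (list_encode ys))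
        \<longleftrightarrow> ?F k (map ((!) hs) xs)" if "?G k xs" for k xs
      using maps[OF G_sub[OF that]] by auto
    moreover have "(\<exists>k' xs. ?G k' xs \<and> k' = k \<and> maps_code (list_encode hs) (list_encode xs) (list_encode ys))
        \<longleftrightarrow> (\<exists>xs. ?G k xs \<and> ys = map ((!) hs) xs)" for k ys
      using maps[OF G_sub] by blast
    ultimately show ?thesis by simp
  qed
  also have "\<dots> \<longleftrightarrow> embedding ((!) hs) (structure_of n G) (structure_of m F)"
  proof (cases "inj_on ((!) hs) {..<n}")
    case inj: True
    \<comment> \<open>by injectivity, the only preimage of a tuple in the range of the map is the given one\<close>
    have map_inj: "xs = ys"
      if "set xs \<subseteq> {..<n}" "set ys \<subseteq> {..<n}" "map ((!) hs) xs = map ((!) hs) ys" for xs ys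
      using that inj by (meson inj_on_map_eq_map inj_on_subset le_sup_iff)
    have "(\<forall>k xs. ?G k xs \<longrightarrow> ?F k (map ((!) hs) xs)) \<and>
      (\<forall>k ys. ?F k ys \<longrightarrow> (\<exists>xs. set xs \<subseteq> {..<n} \<and> ys = map ((!) hs) xs) \<longrightarrow>
      (\<exists>xs. ?G k xs \<and> ys = map ((!) hs) xs)) \<longleftrightarrow>
      (\<forall>k xs. set xs \<subseteq> {..<n} \<longrightarrow> (?G k xs \<longleftrightarrow> ?F k (map ((!) hs) xs)))" (is "?L1 \<and> ?L2 \<longleftrightarrow> ?R")
    proof
      assume L12: "?L1 \<and> ?L2"
      show ?R
      proof (intro allI impI iffI)
        fix k xs assume xs: "set xs \<subseteq> {..<n}" and "?F k (map ((!) hs) xs)"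
        then obtain xs' where "?G k xs'" "map ((!) hs) xs = map ((!) hs) xs'" using L12 by blast
        then show "?G k xs" using map_inj[OF xs G_sub] by blast
      qed (use L12 in blast)
    next
      assume ?R
      then show "?L1 \<and> ?L2" using G_sub by blast
    qed
    then show ?thesis using inj by (auto simp: embedding_def)
  qed (simp add: embedding_def)
  finally show ?thesis using len by simp
qed (simp add: codes_embedding_def)

section \<open>Recursive bounds on codes\<close>

lemma prod_encode_mono:
  assumes "a \<le> a'" and "b \<le> b'"
  shows "prod_encode (a, b) \<le> prod_encode (a', b')"
proof -
  have "mono triangle" unfolding mono_iff_le_Suc by simp
  then have "triangle (a + b) \<le> triangle (a' + b')" by (rule monoD) (use assms in simp)
  then show ?thesis using assms by (simp add: prod_encode_def)
qed

text \<open>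
  The code of the list of length \<open>n\<close> with all entries equal to \<open>m\<close>.
\<close>

definition list_bound :: "nat \<Rightarrow> nat \<Rightarrow> nat" where
  "list_bound m n = rec_nat 0 (\<lambda>_ r. Suc (prod_encode (m, r))) n"

lemma computable_list_bound [recursive_intros]:
  assumes "computable n f" and "computable n g"
  shows "computable n (\<lambda>xs. list_bound (f xs) (g xs))"
proof (rule computable_comp2[OF _ assms])
  show "computable 2 (\<lambda>xs. list_bound (xs ! 0) (xs ! 1))"
    unfolding list_bound_def by (intro recursive_intros) auto
qed

lemma list_encode_le_list_bound:
  assumes "length xs \<le> n" and "set xs \<subseteq> {..m}"
  shows "list_encode xs \<le> list_bound m n"
  using assms
proof (induction n arbitrary: xs)
  case (Suc n)
  then show ?case
    by (cases xs) (auto simp: list_bound_def intro!: prod_encode_mono)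
qed (simp add: list_bound_def)

lemma less_power_if_set_decode_subset:
  assumes "set_decode F \<subseteq> {..<b}"
  shows "F < 2 ^ b"
proof -
  have "set_encode {..<b} < 2 ^ b"
    by (induction b) (simp_all add: lessThan_Suc)
  moreover have "F \<le> set_encode {..<b}"
    using assms by (intro subset_decode_imp_le) simp
  ultimately show ?thesis by simp
qed

text \<open>
  On a structure with at most \<open>m\<close> elements, by non-repetition, a symbol of the infinite part has an empty
  relation if its arity exceeds \<open>m\<close>. As the arities ascend and each occurs finitely often, the relevant
  symbols end at the first one beyond the finite part of arity greater than \<open>m\<close>, which is found by an
  unbounded search.
\<close>

lemma symbol_bound:
  assumes L: "finite_type L \<or> infinite_type L \<and> effective_arities L"
  obtains K where "recursive_fun K"
    and "\<And>m k. k \<in> preds L \<Longrightarrow> k \<le> nfin L \<or> arity L k \<le> m \<Longrightarrow> k \<le> K m"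
  using L
proof
  assume fin: "finite_type L"
  show thesis
  proof (rule that)
    show "recursive_fun (\<lambda>_. nfin L)"
      unfolding recursive_fun_iff_computable by (rule computable_const)
  qed (use fin in \<open>auto simp: finite_type_def\<close>)
next
  assume inf: "infinite_type L \<and> effective_arities L"
  then obtain ar where ar: "recursive_fun ar" "\<And>k. k \<in> preds L \<Longrightarrow> ar k = arity L k"
    unfolding effective_arities_def by blast
  have preds: "preds L = {1..}" and mono: "mono_on {nfin L<..} (arity L)"
    and finite: "\<And>l. finite {k. nfin L < k \<and> arity L k = l}"
    using inf by (auto simp: infinite_type_def)
  let ?K = "\<lambda>m. LEAST j. nfin L < j \<and> m < ar j"
  have ex: "\<exists>j. nfin L < j \<and> m < ar j" for m
  proof -
    have "finite (\<Union>l\<le>m. {k. nfin L < k \<and> arity L k = l})" using finite by simp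
    moreover have "infinite {nfin L<..}" by (rule infinite_Ioi)
    ultimately have "\<not> {nfin L<..} \<subseteq> (\<Union>l\<le>m. {k. nfin L < k \<and> arity L k = l})"
      using finite_subset by blast
    then obtain j where "nfin L < j" "j \<notin> (\<Union>l\<le>m. {k. nfin L < k \<and> arity L k = l})"
      by auto
    then have "nfin L < j" "m < arity L j" "j \<in> preds L" by (auto simp: not_le preds)
    then show ?thesis using ar(2) by auto
  qed
  show thesis
  proof (rule that)
    have "computable 1 (\<lambda>xs. ?K (xs ! 0))"
      by (intro recursive_intros computable_comp1[OF ar(1)[unfolded recursive_fun_iff_computable]])
        (auto simp: ex)
    then show "recursive_fun ?K" by (simp add: recursive_fun_iff_computable)
  next
    fix m k assume k: "k \<in> preds L" "k \<le> nfin L \<or> arity L k \<le> m"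
    have K: "nfin L < ?K m \<and> m < ar (?K m)" by (rule LeastI_ex[OF ex])
    show "k \<le> ?K m"
    proof (rule ccontr)
      assume less: "\<not> k \<le> ?K m"
      then have "arity L (?K m) \<le> arity L k"
        using K by (intro mono_onD[OF mono]) auto
      moreover have "ar (?K m) = arity L (?K m)"
        using K by (intro ar(2)) (auto simp: preds)
      ultimately show False using k(2) less K by linarith
    qed
  qed
qed

text \<open>
  Stated for the combination of both conditions because \<open>arity L\<close> is arbitrary, hence possibly not
  recursive, outside the language.
\<close>

lemma decidable_symbol:
  assumes L: "finite_type L \<or> infinite_type L \<and> effective_arities L"
    and f: "computable n f" and g: "computable n g"
  shows "decidable n (\<lambda>xs. f xs \<in> preds L \<and> arity L (f xs) = g xs)"
proof (rule decidable_comp2[OF _ f g])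
  obtain ar where ar: "recursive_fun ar" "\<And>k. k \<in> preds L \<Longrightarrow> ar k = arity L k"
    using L finite_type_effective_arities unfolding effective_arities_def by blast
  note ar_intro = computable_comp1[OF ar(1)[unfolded recursive_fun_iff_computable]]
  have "decidable 2 (\<lambda>xs. xs ! 0 \<in> preds L)"
    using L
  proof
    assume "finite_type L"
    then have "(1 \<le> xs ! 0 \<and> xs ! 0 \<le> nfin L) = (xs ! 0 \<in> preds L)" for xs
      by (simp add: finite_type_def)
    moreover have "decidable 2 (\<lambda>xs. 1 \<le> xs ! 0 \<and> xs ! 0 \<le> nfin L)"
      by (intro recursive_intros) auto
    ultimately show ?thesis by simp
  next
    assume "infinite_type L \<and> effective_arities L"
    then have "(1 \<le> xs ! 0) = (xs ! 0 \<in> preds L)" for xs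
      by (simp add: infinite_type_def)
    moreover have "decidable 2 (\<lambda>xs. 1 \<le> xs ! 0)"
      by (intro recursive_intros) auto
    ultimately show ?thesis by simp
  qed
  then have "decidable 2 (\<lambda>xs. xs ! 0 \<in> preds L \<and> ar (xs ! 0) = xs ! 1)"
    by (intro recursive_intros ar_intro) auto
  then show "decidable 2 (\<lambda>xs. xs ! 0 \<in> preds L \<and> arity L (xs ! 0) = xs ! 1)"
    by (rule decidable_cong) (use ar(2) in auto)
qed

text \<open>
  With the symbols bounded, so are the arities, hence the codes of the possible facts and the codes of
  sets of such facts.
\<close>

lemma structure_code_bound:
  assumes L: "finite_type L \<or> infinite_type L \<and> effective_arities L"
  obtains b where "recursive_fun b"
    and "\<And>m n F. codes_structure L n F \<Longrightarrow> n \<le> m \<Longrightarrow> F < b m"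
proof -
  obtain K where K: "recursive_fun K"
    "\<And>m k. k \<in> preds L \<Longrightarrow> k \<le> nfin L \<or> arity L k \<le> m \<Longrightarrow> k \<le> K m"
    using symbol_bound[OF L] by blast
  obtain ar where ar: "recursive_fun ar" "\<And>k. k \<in> preds L \<Longrightarrow> ar k = arity L k"
    using L finite_type_effective_arities unfolding effective_arities_def by blast
  \<comment> \<open>the sum of the arities up to a symbol, as a bound on each of them\<close>
  define s where "s = rec_nat 0 (\<lambda>k r. r + ar k)"
  have s: "ar k \<le> s n" if "k < n" for k n
    using that by (induction n) (auto simp: s_def less_Suc_eq)
  let ?b = "\<lambda>m. 2 ^ Suc (prod_encode (K m, list_bound m (s (Suc (K m)))))"
  show thesis
  proof (rule that)
    show "recursive_fun ?b"
      unfolding recursive_fun_iff_computable s_def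
      by (intro recursive_intros computable_comp1[OF ar(1)[unfolded recursive_fun_iff_computable]]
          computable_comp1[OF K(1)[unfolded recursive_fun_iff_computable]]) auto
  next
    fix m n F assume F: "codes_structure L n F" and "n \<le> m"
    have "prod_encode (k, list_encode xs) \<le> prod_encode (K m, list_bound m (s (Suc (K m))))"
      if "prod_encode (k, list_encode xs) \<in> set_decode F" for k xs
    proof -
      have *: "is_struct L (structure_of n F)" "xs \<in> rel (structure_of n F) k"
        using F that by (simp_all add: codes_structure_iff)
      then have k: "k \<in> preds L" using rel_outside_empty by blast
      then have xs: "length xs = arity L k" "set xs \<subseteq> {..<n}" "nfin L < k \<longrightarrow> distinct xs"
        using * unfolding is_struct_def by (metis carrier_structure_of)+
      have "arity L k \<le> m" if "nfin L < k"
      proof -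
        have "arity L k = card (set xs)" using xs that by (simp add: distinct_card)
        also have "\<dots> \<le> n" using card_mono[OF _ xs(2)] by simp
        finally show ?thesis using \<open>n \<le> m\<close> by simp
      qed
      then have "k \<le> K m" using K(2)[OF k] by (meson not_le)
      moreover from this have "length xs \<le> s (Suc (K m))"
        using s[of k "Suc (K m)"] ar(2)[OF k] xs(1) by simp
      moreover have "set xs \<subseteq> {..m}" using xs(2) \<open>n \<le> m\<close> by auto
      ultimately show ?thesis by (intro prod_encode_mono list_encode_le_list_bound)
    qed
    then have "set_decode F \<subseteq> {..<Suc (prod_encode (K m, list_bound m (s (Suc (K m)))))}"
      by (metis fact_code_cases less_Suc_eq_le lessThan_iff subsetI)
    then show "F < ?b m" by (rule less_power_if_set_decode_subset)
  qed
qed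

section \<open>Decidability of the arithmetized notions\<close>

lemma decidable_codes_structure:
  assumes L: "finite_type L \<or> infinite_type L \<and> effective_arities L"
    and f: "computable n f" and g: "computable n g"
  shows "decidable n (\<lambda>xs. codes_structure L (f xs) (g xs))"
proof (rule decidable_comp2[OF _ f g])
  show "decidable 2 (\<lambda>xs. codes_structure L (xs ! 0) (xs ! 1))"
    \<comment> \<open>regrouping lets the two conditions on symbol and arity be treated as one\<close>
    unfolding codes_structure_def conj_assoc[symmetric]
    by (intro recursive_intros decidable_symbol[OF L]) auto
qed

lemma decidable_maps_code [recursive_intros]:
  assumes "computable n f" and "computable n g" and "computable n h"
  shows "decidable n (\<lambda>xs. maps_code (f xs) (g xs) (h xs))"
proof (rule decidable_comp3[OF _ assms])
  show "decidable 3 (\<lambda>xs. maps_code (xs ! 0) (xs ! 1) (xs ! 2))"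
    unfolding maps_code_def by (intro recursive_intros) auto
qed

lemma decidable_codes_embedding [recursive_intros]:
  assumes "computable n a" and "computable n b" and "computable n c" and "computable n d"
    and "computable n e"
  shows "decidable n (\<lambda>xs. codes_embedding (a xs) (b xs) (c xs) (d xs) (e xs))"
proof (rule decidable_comp5[OF _ assms])
  show "decidable 5 (\<lambda>xs. codes_embedding (xs ! 0) (xs ! 1) (xs ! 2) (xs ! 3) (xs ! 4))"
    unfolding codes_embedding_def by (intro recursive_intros) auto
qed

text \<open>
  The truth of the formula with code \<open>y\<close> under the assignment \<open>e\<close>, where \<open>T\<close> codes the set of true formulas
  with smaller codes. The first component of \<open>y\<close> is the tag that distinguishes the formula constructors.
\<close>

definition truth_step :: "nat \<Rightarrow> nat \<Rightarrow> nat \<Rightarrow> nat \<Rightarrow> bool" where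
  "truth_step F e y T \<longleftrightarrow>
     fst_code y = 0 \<and> nth_code e (fst_code (snd_code y)) = nth_code e (snd_code (snd_code y)) \<or>
     fst_code y = 1 \<and> (\<exists>z<F. z \<in> set_decode F \<and> fst_code z = fst_code (snd_code y) \<and>
       maps_code e (snd_code (snd_code y)) (snd_code z)) \<or>
     fst_code y = 2 \<and> snd_code y \<notin> set_decode T \<or>
     fst_code y = 3 \<and> fst_code (snd_code y) \<in> set_decode T \<and> snd_code (snd_code y) \<in> set_decode T \<or>
     fst_code y = 4 \<and> snd_code (snd_code y) \<in> set_decode T"

text \<open>
  Course-of-values recursion over codes of formulas as a primitive recursion: the truth values found so
  far are accumulated as the binary digits of a number.
\<close>

definition truth_set :: "nat \<Rightarrow> nat \<Rightarrow> nat \<Rightarrow> nat" where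
  "truth_set F e n = rec_nat 0 (\<lambda>y T. if truth_step F e y T then 2 ^ y + T else T) n"

lemma computable_truth_set [recursive_intros]:
  assumes "computable n f" and "computable n g" and "computable n h"
  shows "computable n (\<lambda>xs. truth_set (f xs) (g xs) (h xs))"
proof (rule computable_comp3[OF _ assms])
  have step: "decidable 4 (\<lambda>xs. truth_step (xs ! 0) (xs ! 1) (xs ! 2) (xs ! 3))"
    unfolding truth_step_def by (intro recursive_intros) auto
  show "computable 3 (\<lambda>xs. truth_set (xs ! 0) (xs ! 1) (xs ! 2))"
    unfolding truth_set_def by (intro recursive_intros decidable_comp4[OF step]) auto
qed

lemma mem_truth_set_iff:
  "y \<in> set_decode (truth_set F e n) \<longleftrightarrow> y < n \<and> truth_step F e y (truth_set F e y)"
proof (induction n arbitrary: y)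
  case (Suc n)
  have "n \<notin> set_decode (truth_set F e n)" by (simp add: Suc)
  moreover have "truth_set F e (Suc n) = (if truth_step F e n (truth_set F e n)
      then 2 ^ n + truth_set F e n else truth_set F e n)"
    by (simp add: truth_set_def)
  \<comment> \<open>adding \<open>2 ^ n\<close> inserts \<open>n\<close>, as this digit is still 0\<close>
  ultimately have "set_decode (truth_set F e (Suc n)) = (if truth_step F e n (truth_set F e n)
      then insert n (set_decode (truth_set F e n)) else set_decode (truth_set F e n))"
    by (simp add: set_decode_plus_power_2)
  then show ?case using Suc by (auto simp: less_Suc_eq)
qed (simp add: truth_set_def)

lemma fm_code_mem_truth_set:
  assumes "fm_code \<phi> < length es"
  shows "fm_code \<phi> \<in> set_decode (truth_set F (list_encode es) n) \<longleftrightarrow>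
    fm_code \<phi> < n \<and> matrix_sat (structure_of m F) ((!) es) \<phi>"
  using assms
proof (induction \<phi> arbitrary: n)
  case (Equal i j)
  have "i < length es" "j < length es"
    using Equal le_prod_encode_1[of i j] le_prod_encode_2[of j i]
      le_prod_encode_2[of "prod_encode (i, j)" 0]
    by simp_all
  then show ?case by (subst mem_truth_set_iff) (simp add: truth_step_def)
next
  case (Atom k vs)
  have "v < length es" if "v \<in> set vs" for v
    using Atom le_list_encode[OF that] le_prod_encode_2[of "list_encode vs" k]
      le_prod_encode_2[of "prod_encode (k, list_encode vs)" 1] by simp
  then have "maps_code (list_encode es) (list_encode vs) (list_encode us) \<longleftrightarrow> us = map ((!) es) vs" for us
    by (rule maps_code_list_encode)
  then show ?case by (subst mem_truth_set_iff) (simp add: truth_step_def ex_facts)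
next
  case (Neg \<phi>)
  then have "fm_code \<phi> < length es" using fm_code_subformula(1)[of \<phi>] by linarith
  note IH = Neg.IH[OF this]
  show ?case
    using fm_code_subformula(1)[of \<phi>]
    by (subst mem_truth_set_iff) (auto simp: truth_step_def IH)
next
  case (Conj \<phi> \<psi>)
  then have "fm_code \<phi> < length es" "fm_code \<psi> < length es"
    using fm_code_subformula(2)[of \<phi> \<psi>] fm_code_subformula(3)[of \<psi> \<phi>] by linarith+
  note IH = Conj.IH(1)[OF this(1)] Conj.IH(2)[OF this(2)]
  show ?case
    using fm_code_subformula(2)[of \<phi> \<psi>] fm_code_subformula(3)[of \<psi> \<phi>]
    by (subst mem_truth_set_iff) (auto simp: truth_step_def IH)
next
  case (Forall i \<phi>)
  then have "fm_code \<phi> < length es" using fm_code_subformula(4)[of \<phi> i] by linarith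
  note IH = Forall.IH[OF this]
  show ?case
    using fm_code_subformula(4)[of \<phi> i]
    by (subst mem_truth_set_iff) (auto simp: truth_step_def IH)
qed

text \<open>
  An assignment is given by the values of the variables up to \<open>x\<close>; this covers all variables of the
  formula with code \<open>x\<close>.
\<close>

definition codes_countermodel :: "nat \<Rightarrow> nat \<Rightarrow> nat \<Rightarrow> bool" where
  "codes_countermodel m F x \<longleftrightarrow> (\<exists>e<Suc (list_bound m (Suc x)).
     len_code e = Suc x \<and> (\<forall>i<Suc x. nth_code e i < m) \<and>
     x \<notin> set_decode (truth_set F e (Suc x)))"

lemma decidable_codes_countermodel [recursive_intros]:
  assumes "computable n f" and "computable n g" and "computable n h"
  shows "decidable n (\<lambda>xs. codes_countermodel (f xs) (g xs) (h xs))"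
proof (rule decidable_comp3[OF _ assms])
  show "decidable 3 (\<lambda>xs. codes_countermodel (xs ! 0) (xs ! 1) (xs ! 2))"
    unfolding codes_countermodel_def by (intro recursive_intros) auto
qed

lemma codes_countermodel_iff:
  assumes \<phi>: "universal_sentence L \<phi>" and "0 < m"
  shows "codes_countermodel m F (fm_code \<phi>) \<longleftrightarrow> \<not> models (structure_of m F) \<phi>"
proof -
  let ?x = "fm_code \<phi>" and ?A = "structure_of m F"
  have "carrier ?A \<noteq> {}" using \<open>0 < m\<close> by (simp add: lessThan_empty_iff)
  note models = models_universal_sentence[OF \<phi> this]
  show ?thesis
  proof
    assume "codes_countermodel m F ?x"
    then obtain e where e: "len_code e = Suc ?x" "\<forall>i<Suc ?x. nth_code e i < m"
      "?x \<notin> set_decode (truth_set F e (Suc ?x))"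
      unfolding codes_countermodel_def by blast
    define es where "es = list_decode e"
    have es: "e = list_encode es" by (simp add: es_def)
    have len: "length es = Suc ?x" using e(1) by (simp add: es)
    define d where "d = (\<lambda>i. es ! min i ?x)"
    have "es ! i < m" if "i \<le> ?x" for i using e(2) len that by (simp add: es less_Suc_eq_le)
    then have "range d \<subseteq> carrier ?A" by (auto simp: d_def)
    moreover have "\<not> matrix_sat ?A ((!) es) \<phi>"
      using e(3) fm_code_mem_truth_set[of \<phi> es F "Suc ?x" m] len by (simp add: es)
    then have "\<not> matrix_sat ?A d \<phi>"
      using matrix_sat_cong[of \<phi> "(!) es" d ?A] by (simp add: d_def)
    ultimately show "\<not> models ?A \<phi>" unfolding models by blast
  next
    assume "\<not> models ?A \<phi>"
    then obtain d where d: "range d \<subseteq> carrier ?A" "\<not> matrix_sat ?A d \<phi>"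
      unfolding models by blast
    let ?es = "map d [0..<Suc ?x]"
    have nth: "?es ! i = d i" if "i < Suc ?x" for i
      using that by (simp del: upt_Suc)
    have dm: "d i < m" for i using d(1) by auto
    then have "list_encode ?es \<le> list_bound m (Suc ?x)"
      by (intro list_encode_le_list_bound) (auto simp: less_imp_le simp del: upt_Suc)
    moreover have "\<not> matrix_sat ?A ((!) ?es) \<phi>"
      using d(2) matrix_sat_cong[of \<phi> "(!) ?es" d ?A] nth by (simp add: less_Suc_eq_le del: upt_Suc)
    then have "?x \<notin> set_decode (truth_set F (list_encode ?es) (Suc ?x))"
      using fm_code_mem_truth_set[of \<phi> ?es F "Suc ?x" m] by (simp del: upt_Suc)
    moreover have "len_code (list_encode ?es) = Suc ?x" by (simp del: upt_Suc)
    moreover have "\<forall>i<Suc ?x. nth_code (list_encode ?es) i < m"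
      using nth dm by (simp del: upt_Suc)
    ultimately show "codes_countermodel m F ?x"
      unfolding codes_countermodel_def by (intro exI[of _ "list_encode ?es"]) (simp add: le_imp_less_Suc del: upt_Suc)
  qed
qed

section \<open>Decision of the universal theory\<close>

text \<open>
  A set of numbers of presentations decides membership up to isomorphism because equal numbers force
  isomorphism: a recursive inverse returns one and the same presentation, isomorphic to both structures.
  Translating standard codes into Goedel numbers is recursive as well.
\<close>

lemma recursive_structs_membership:
  assumes L: "finite_type L \<or> infinite_type L" and H: "recursive_structs L H"
  obtains P where "decidable 1 (\<lambda>xs. P (xs ! 0))"
    and "\<And>A. A \<in> finite_presentations L \<Longrightarrow> P (struct_code A) \<longleftrightarrow> (\<exists>C\<in>H. isomorphic L C A)"
proof -
  obtain g where g: "goedel_numbering L g"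
    and rec: "recursive_set (g ` {B \<in> finite_presentations L. \<exists>A\<in>H. isomorphic L A B})"
    using H unfolding recursive_structs_def by blast
  let ?S = "g ` {B \<in> finite_presentations L. \<exists>A\<in>H. isomorphic L A B}"
  obtain c d where c: "recursive_fun c" "\<And>A. A \<in> finite_presentations L \<Longrightarrow> g A = c (struct_code A)"
    and d: "\<And>A. A \<in> finite_presentations L \<Longrightarrow>
      \<exists>B\<in>finite_presentations L. isomorphic L A B \<and> d (g A) = struct_code B"
    using g unfolding goedel_numbering_def by blast
  have g_inj: "isomorphic L A B"
    if A: "A \<in> finite_presentations L" and B: "B \<in> finite_presentations L" and eq: "g A = g B" for A B
  proof -
    obtain A' where A': "A' \<in> finite_presentations L" "isomorphic L A A'" "d (g A) = struct_code A'"
      using d[OF A] by blast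
    obtain B' where B': "B' \<in> finite_presentations L" "isomorphic L B B'" "d (g B) = struct_code B'"
      using d[OF B] by blast
    have "A' = B'" using struct_code_inject[OF L A'(1) B'(1)] A'(3) B'(3) eq by simp
    then show ?thesis using isomorphic_trans[OF A'(2)] isomorphic_sym[OF B'(2)] by simp
  qed
  show thesis
  proof (rule that)
    have "decidable 1 (\<lambda>xs. xs ! 0 \<in> ?S)"
      using rec unfolding recursive_set_def recursive_fun_iff_computable decidable_def .
    from decidable_comp1[OF this c(1)[unfolded recursive_fun_iff_computable]]
    show "decidable 1 (\<lambda>xs. c (xs ! 0) \<in> ?S)" .
  next
    fix A assume A: "A \<in> finite_presentations L"
    show "c (struct_code A) \<in> ?S \<longleftrightarrow> (\<exists>C\<in>H. isomorphic L C A)"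
    proof
      assume "c (struct_code A) \<in> ?S"
      then obtain B C where "B \<in> finite_presentations L" "g B = g A" "C \<in> H" "isomorphic L C B"
        using c(2)[OF A] by auto
      then show "\<exists>C\<in>H. isomorphic L C A" using g_inj[OF _ A] isomorphic_trans by blast
    next
      assume "\<exists>C\<in>H. isomorphic L C A"
      then have "g A \<in> ?S" using A by blast
      then show "c (struct_code A) \<in> ?S" using c(2)[OF A] by simp
    qed
  qed
qed

text \<open>
  A member of \<open>H\<close> that embeds into a structure with \<open>m\<close> elements is finite, so it has a presentation with at
  most \<open>m\<close> elements, and the embedding is a list of at most \<open>m\<close> entries. All codes involved are bounded in
  terms of \<open>m\<close>.
\<close>

lemma not_omits_structure_of_iff:
  assumes L: "finite_type L \<or> infinite_type L" and H: "\<forall>C\<in>H. is_struct L C"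
    and F: "codes_structure L m F"
    and P: "\<And>A. A \<in> finite_presentations L \<Longrightarrow> P (struct_code A) \<longleftrightarrow> (\<exists>C\<in>H. isomorphic L C A)"
    and b: "\<And>m n F. codes_structure L n F \<Longrightarrow> n \<le> m \<Longrightarrow> F < b m"
  shows "\<not> omits H (structure_of m F) \<longleftrightarrow> (\<exists>n<Suc m. \<exists>G<b m. \<exists>h<Suc (list_bound m m).
    codes_structure L n G \<and> codes_embedding n G m F h \<and> P (prod_encode (n, G)))"
proof
  let ?A = "structure_of m F"
  assume "\<not> omits H ?A"
  then obtain C p where C: "C \<in> H" "embedding p C ?A" unfolding omits_def by blast
  then have "finite (carrier C)"
    unfolding embedding_def by (metis carrier_structure_of finite_imageD finite_lessThan finite_subset)
  moreover have C_struct: "is_struct L C" using H C(1) by blast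
  ultimately obtain B where B: "B \<in> finite_presentations L" "isomorphic L C B"
    using isomorphic_finite_presentation by blast
  obtain n G where G: "B = structure_of n G" "codes_structure L n G"
    using finite_presentation_cases[OF L B(1)] by blast
  obtain q where "embedding q B C"
    using isomorphic_imp_embedding[OF isomorphic_sym[OF B(2)]] B(1) C_struct
    by (auto simp: finite_presentations_def)
  then have r: "embedding (p \<circ> q) B ?A" using embedding_comp[OF C(2)] by blast
  define hs where "hs = map (p \<circ> q) [0..<n]"
  have "embedding ((!) hs) B ?A"
    using r by (rule embedding_cong) (simp add: hs_def G)
  then have "codes_embedding n G m F (list_encode hs)"
    using G by (simp add: codes_embedding_iff) (simp add: hs_def)
  moreover have sub: "set hs \<subseteq> {..<m}"
  proof -
    have "(p \<circ> q) ` {..<n} \<subseteq> {..<m}"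
      using r unfolding embedding_def G carrier_structure_of by blast
    then show ?thesis by (simp only: hs_def set_map set_upt atLeast0LessThan)
  qed
  moreover have "n \<le> m"
    using r card_inj_on_le[of "p \<circ> q" "{..<n}" "{..<m}"] by (simp add: embedding_def G)
  moreover from this sub have "list_encode hs \<le> list_bound m m"
    by (intro list_encode_le_list_bound) (auto simp: hs_def)
  moreover have "P (prod_encode (n, G))"
    using P[OF B(1)] B(2) C(1) by (auto simp: G struct_code_structure_of)
  ultimately show "\<exists>n<Suc m. \<exists>G<b m. \<exists>h<Suc (list_bound m m).
    codes_structure L n G \<and> codes_embedding n G m F h \<and> P (prod_encode (n, G))"
    using G(2) b[OF G(2)] le_imp_less_Suc by blast
next
  let ?A = "structure_of m F"
  assume "\<exists>n<Suc m. \<exists>G<b m. \<exists>h<Suc (list_bound m m).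
    codes_structure L n G \<and> codes_embedding n G m F h \<and> P (prod_encode (n, G))"
  then obtain n G h where G: "codes_structure L n G"
    and h: "codes_embedding n G m F h" and "P (prod_encode (n, G))" by blast
  let ?B = "structure_of n G"
  have B: "?B \<in> finite_presentations L" by (rule structure_of_finite_presentation[OF G])
  obtain C where C: "C \<in> H" "isomorphic L C ?B"
    using P[OF B] \<open>P (prod_encode (n, G))\<close> by (auto simp: struct_code_structure_of)
  have "embedding ((!) (list_decode h)) ?B ?A"
    using h codes_embedding_iff[OF G, of m F "list_decode h"] by simp
  moreover obtain p where "embedding p C ?B"
    using isomorphic_imp_embedding[OF C(2)] H C(1) B by (auto simp: finite_presentations_def)
  ultimately show "\<not> omits H ?A"
    unfolding omits_def using C(1) embedding_comp by blast
qed

theorem theorem3p1: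
  fixes L :: lang and K H :: "'a fo_struct set"
  assumes "infinite (UNIV :: 'a set)"
    and "finite_type L \<or> infinite_type L \<and> effective_arities L"
    and "abstract_class L K"
    and "axiomatizable L K"
    and "hereditary K"
    and "minimal_forbidden L K H"
    and "recursive_structs L H"
  shows "decidable_universal_theory L K"
proof -
  note L = assms(2)
  then have L': "finite_type L \<or> infinite_type L" by blast
  have H: "\<forall>C\<in>H. is_struct L C" and K: "K = Forb L H"
    using assms(6) by (simp_all add: minimal_forbidden_def)
  obtain P where P: "decidable 1 (\<lambda>xs. P (xs ! 0))"
    "\<And>A. A \<in> finite_presentations L \<Longrightarrow> P (struct_code A) \<longleftrightarrow> (\<exists>C\<in>H. isomorphic L C A)"
    using recursive_structs_membership[OF L' assms(7)] by blast
  obtain b where b: "recursive_fun b"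
    "\<And>m n F. codes_structure L n F \<Longrightarrow> n \<le> m \<Longrightarrow> F < b m"
    using structure_code_bound[OF L] by blast
  define forbidden where "forbidden = (\<lambda>m F. \<exists>n<Suc m. \<exists>G<b m. \<exists>h<Suc (list_bound m m).
    codes_structure L n G \<and> codes_embedding n G m F h \<and> P (prod_encode (n, G)))"
  \<comment> \<open>by \<open>universal_theory_Forb_iff\<close>, sizes up to \<open>x + 1\<close> suffice for the sentence with code \<open>x\<close>\<close>
  define refuted where "refuted = (\<lambda>x. \<exists>m<Suc (Suc x). \<exists>F<b m.
    codes_structure L m F \<and> \<not> forbidden m F \<and> codes_countermodel m F x)"
  note b_intro = computable_comp1[OF b(1)[unfolded recursive_fun_iff_computable]]
  have forbidden: "decidable 2 (\<lambda>xs. forbidden (xs ! 0) (xs ! 1))"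
    unfolding forbidden_def
    by (intro recursive_intros b_intro decidable_comp1[OF P(1)] decidable_codes_structure[OF L]) auto
  have "decidable 1 (\<lambda>xs. refuted (xs ! 0))"
    unfolding refuted_def
    by (intro recursive_intros b_intro decidable_comp2[OF forbidden] decidable_codes_structure[OF L]) auto
  then have "computable 1 (\<lambda>xs. if refuted (xs ! 0) then 0 else 1)"
    by (intro recursive_intros)
  then have "recursive_fun (\<lambda>x. if refuted x then 0 else 1)"
    by (simp add: recursive_fun_iff_computable)
  moreover have "refuted (fm_code \<phi>) \<longleftrightarrow> \<phi> \<notin> universal_theory L K"
    if \<phi>: "universal_sentence L \<phi>" for \<phi>
  proof -
    have forb: "forbidden m F \<longleftrightarrow> \<not> omits H (structure_of m F)" if "codes_structure L m F" for m F
      unfolding forbidden_def using not_omits_structure_of_iff[OF L' H that P(2) b(2)] by simp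
    have counter: "codes_countermodel m F (fm_code \<phi>) \<longleftrightarrow> \<not> models (structure_of m F) \<phi>"
      if "codes_structure L m F" for m F
      using codes_countermodel_iff[OF \<phi>] that by (simp add: codes_structure_def)
    have "refuted (fm_code \<phi>) \<longleftrightarrow> (\<exists>B\<in>finite_presentations L.
      card (carrier B) \<le> Suc (fm_code \<phi>) \<and> omits H B \<and> \<not> models B \<phi>)"
    proof
      assume "refuted (fm_code \<phi>)"
      then obtain m F where "m < Suc (Suc (fm_code \<phi>))" "codes_structure L m F"
        "\<not> forbidden m F" "codes_countermodel m F (fm_code \<phi>)"
        unfolding refuted_def by blast
      then show "\<exists>B\<in>finite_presentations L.
          card (carrier B) \<le> Suc (fm_code \<phi>) \<and> omits H B \<and> \<not> models B \<phi>"
        using forb counter structure_of_finite_presentation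
        by (intro bexI[of _ "structure_of m F"]) auto
    next
      assume "\<exists>B\<in>finite_presentations L.
          card (carrier B) \<le> Suc (fm_code \<phi>) \<and> omits H B \<and> \<not> models B \<phi>"
      then obtain B where B: "B \<in> finite_presentations L" "card (carrier B) \<le> Suc (fm_code \<phi>)"
        "omits H B" "\<not> models B \<phi>" by blast
      obtain F where F: "B = structure_of (card (carrier B)) F" "codes_structure L (card (carrier B)) F"
        using finite_presentation_cases[OF L' B(1)] by blast
      have "\<not> forbidden (card (carrier B)) F" "codes_countermodel (card (carrier B)) F (fm_code \<phi>)"
        using forb[OF F(2)] counter[OF F(2)] B(3,4) F(1) by simp_all
      then show "refuted (fm_code \<phi>)"
        unfolding refuted_def using F(2) B(2) b(2)[OF F(2) order_refl] le_imp_less_Suc by blast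
    qed
    also have "\<dots> \<longleftrightarrow> \<phi> \<notin> universal_theory L K"
      unfolding K universal_theory_Forb_iff[OF assms(1) H \<phi>] by blast
    finally show ?thesis .
  qed
  ultimately show ?thesis
    unfolding decidable_universal_theory_def
    by (intro exI[of _ "\<lambda>x. if refuted x then 0 else 1"]) simp
qed

end
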